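(* Let $R$ be a domain. The following statements are equivalent: (i) $R$ is Krull (resp., a UFD); (ii) $R$ is $t$-almost Dedekind and Clifford (resp., Boole) $t$-regular; (iii) $R$ is strongly $t$-discrete, completely integrally closed, and Clifford (resp., Boole) $t$-regular.
   Context: All rings are integral domains. Let $R$ be a domain with quotient field $K$. For fractional ideals $I,J$ of $R$, $(I:J)=\{x\in K : xJ\subseteq I\}$. For a nonzero fractional ideal $I$, put $I^{-1}=(R:I)$, $I_v=(I^{-1})^{-1}$, and $I_t=\bigcup J_v$, where $J$ ranges over the nonzero finitely generated fractional ideals contained in $I$. $I$ is a $t$-ideal if it is nonzero and $I_t=I$. A $t$-prime ideal is a prime ideal that is a $t$-ideal; a $t$-maximal ideal is a maximal element of the set of proper integral $t$-ideals of $R$. The fractional $t$-ideals form a commutative semigroup $F_t(R)$ under $(I,J)\mapsto (IJ)_t$, and $\mathcal S_t(R)=F_t(R)/P(R)$ is the quotient by the group $P(R)$ of nonzero principal fractional ideals (so the classes of $I$ and $J$ coincide iff $I=cJ$ for some $0\neq c\in K$). A commutative semigroup $S$ is Clifford if for every $x\in S$ there is $a\in S$ with $x^2a=x$, and Boolean if $x^2=x$ for every $x\in S$. $R$ is Clifford (resp., Boole) $t$-regular if $\mathcal S_t(R)$ is Clifford (resp., Boolean). $R$ is $t$-almost Dedekind if $R_M$ is a rank-one DVR for each $t$-maximal ideal $M$ of $R$. $R$ is strongly $t$-discrete if $(P^2)_t\subsetneq P$ for every $t$-prime ideal $P$ of $R$. The "resp." version is a second, separate equivalence of three statements, obtained by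 replacing "Krull" with "a UFD" in (i) and "Clifford" with "Boole" in (ii) and (iii). *)

theory Defs
  imports "HOL-Algebra.Algebra" "HOL-Algebra.Algebraic_Closure_Type"
begin

text \<open>
  The quotient field is a field type \<open>'k\<close>, and a domain with quotient field \<open>'k\<close> is a subring
  \<open>R :: 'k set\<close> every element of whose ambient field is a fraction of elements of \<open>R\<close>. Fractional
  ideals and overrings of \<open>R\<close> are then again sets of elements of \<open>'k\<close>.
\<close>

abbreviation field_ring :: "'k::field ring"
  where "field_ring \<equiv> ring_of_type_algebra"

abbreviation as_ring :: "'k::field set \<Rightarrow> 'k ring"
  where "as_ring R \<equiv> field_ring\<lparr>carrier := R\<rparr>"

definition domain_with_quotient_field :: "'k::field set \<Rightarrow> bool"
  where "domain_with_quotient_field R \<longleftrightarrow>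
    subring R field_ring \<and> (\<forall>x. \<exists>a\<in>R. \<exists>b\<in>R. b \<noteq> 0 \<and> x = a / b)"

subsection \<open>Fractional ideals and the \<open>v\<close>- and \<open>t\<close>-operations\<close>

definition fractional_ideal :: "'k::field set \<Rightarrow> 'k set \<Rightarrow> bool"
  where "fractional_ideal R I \<longleftrightarrow>
    0 \<in> I \<and> (\<forall>x\<in>I. \<forall>y\<in>I. x + y \<in> I) \<and> (\<forall>r\<in>R. \<forall>x\<in>I. r * x \<in> I) \<and>
    (\<exists>d\<in>R. d \<noteq> 0 \<and> (\<forall>x\<in>I. d * x \<in> R))"

definition finitely_generated :: "'k::field set \<Rightarrow> 'k set \<Rightarrow> bool"
  where "finitely_generated R J \<longleftrightarrow>
    (\<exists>S. finite S \<and> J = {\<Sum>s\<in>S. r s * s | r. \<forall>s\<in>S. r s \<in> R})"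

definition colon :: "'k::field set \<Rightarrow> 'k set \<Rightarrow> 'k set"
  where "colon I J = {x. \<forall>y\<in>J. x * y \<in> I}"

definition inverse_ideal :: "'k::field set \<Rightarrow> 'k set \<Rightarrow> 'k set"
  where "inverse_ideal R I = colon R I"

definition v_closure :: "'k::field set \<Rightarrow> 'k set \<Rightarrow> 'k set"
  where "v_closure R I = inverse_ideal R (inverse_ideal R I)"

definition t_closure :: "'k::field set \<Rightarrow> 'k set \<Rightarrow> 'k set"
  where "t_closure R I =
    \<Union> {v_closure R J | J. fractional_ideal R J \<and> J \<noteq> {0} \<and> finitely_generated R J \<and> J \<subseteq> I}"

definition t_ideal :: "'k::field set \<Rightarrow> 'k set \<Rightarrow> bool"
  where "t_ideal R I \<longleftrightarrow> fractional_ideal R I \<and> I \<noteq> {0} \<and> t_closure R I = I"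

definition t_prime :: "'k::field set \<Rightarrow> 'k set \<Rightarrow> bool"
  where "t_prime R P \<longleftrightarrow> primeideal P (as_ring R) \<and> t_ideal R P"

definition t_maximal :: "'k::field set \<Rightarrow> 'k set \<Rightarrow> bool"
  where "t_maximal R M \<longleftrightarrow>
    t_ideal R M \<and> M \<subset> R \<and> (\<forall>N. t_ideal R N \<and> N \<subset> R \<and> M \<subseteq> N \<longrightarrow> N = M)"

subsection \<open>The \<open>t\<close>-class semigroup\<close>

text \<open>
  The product \<open>I \<cdot>\<^bsub>field_ring\<^esub> J\<close> of fractional ideals is the set of finite sums of products of
  elements of \<open>I\<close> and \<open>J\<close>; being closed under multiplication by \<open>R\<close>, it does not depend on \<open>R\<close>.
\<close>

definition t_ideal_monoid :: "'k::field set \<Rightarrow> 'k set monoid"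
  where "t_ideal_monoid R =
    \<lparr>carrier = {I. t_ideal R I},
     monoid.mult = (\<lambda>I J. t_closure R (I \<cdot>\<^bsub>field_ring\<^esub> J)),
     one = R\<rparr>"

definition principal_ideals :: "'k::field set \<Rightarrow> 'k set set"
  where "principal_ideals R = {(*) c ` R | c. c \<noteq> 0}"

text \<open>
  In the quotient below the class of \<open>I\<close> is the coset of all \<open>(cR I)\<^sub>t = cI\<close> with \<open>c \<noteq> 0\<close>, and
  classes are multiplied elementwise. The library's \<open>Mod\<close> is defined for arbitrary monoid records.
\<close>

definition t_class_semigroup :: "'k::field set \<Rightarrow> 'k set set monoid"
  where "t_class_semigroup R = t_ideal_monoid R Mod principal_ideals R"

definition clifford_semigroup :: "('a, 'b) monoid_scheme \<Rightarrow> bool"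
  where "clifford_semigroup S \<longleftrightarrow>
    (\<forall>x\<in>carrier S. \<exists>a\<in>carrier S. (x \<otimes>\<^bsub>S\<^esub> x) \<otimes>\<^bsub>S\<^esub> a = x)"

definition boolean_semigroup :: "('a, 'b) monoid_scheme \<Rightarrow> bool"
  where "boolean_semigroup S \<longleftrightarrow> (\<forall>x\<in>carrier S. x \<otimes>\<^bsub>S\<^esub> x = x)"

definition clifford_t_regular :: "'k::field set \<Rightarrow> bool"
  where "clifford_t_regular R \<longleftrightarrow> clifford_semigroup (t_class_semigroup R)"

definition boole_t_regular :: "'k::field set \<Rightarrow> bool"
  where "boole_t_regular R \<longleftrightarrow> boolean_semigroup (t_class_semigroup R)"

subsection \<open>Classes of domains\<close>

text \<open>A normalized discrete valuation; its value at \<open>0\<close>, conventionally infinite, is ignored.\<close>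

definition discrete_valuation :: "('k::field \<Rightarrow> int) \<Rightarrow> bool"
  where "discrete_valuation v \<longleftrightarrow>
    (\<forall>x y. x \<noteq> 0 \<longrightarrow> y \<noteq> 0 \<longrightarrow> v (x * y) = v x + v y) \<and>
    (\<forall>x y. x \<noteq> 0 \<longrightarrow> y \<noteq> 0 \<longrightarrow> x + y \<noteq> 0 \<longrightarrow> min (v x) (v y) \<le> v (x + y)) \<and>
    v ` (UNIV - {0}) = UNIV"

definition rank_one_dvr :: "'k::field set \<Rightarrow> bool"
  where "rank_one_dvr V \<longleftrightarrow>
    (\<exists>v. discrete_valuation v \<and> V = insert 0 {x. x \<noteq> 0 \<and> 0 \<le> v x})"

definition localization :: "'k::field set \<Rightarrow> 'k set \<Rightarrow> 'k set"
  where "localization R M = {x / s | x s. x \<in> R \<and> s \<in> R - M}"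

definition t_almost_dedekind :: "'k::field set \<Rightarrow> bool"
  where "t_almost_dedekind R \<longleftrightarrow> (\<forall>M. t_maximal R M \<longrightarrow> rank_one_dvr (localization R M))"

definition strongly_t_discrete :: "'k::field set \<Rightarrow> bool"
  where "strongly_t_discrete R \<longleftrightarrow>
    (\<forall>P. t_prime R P \<longrightarrow> t_closure R (P \<cdot>\<^bsub>field_ring\<^esub> P) \<subset> P)"

definition completely_integrally_closed :: "'k::field set \<Rightarrow> bool"
  where "completely_integrally_closed R \<longleftrightarrow>
    (\<forall>x. (\<exists>d\<in>R. d \<noteq> 0 \<and> (\<forall>n::nat. d * x ^ n \<in> R)) \<longrightarrow> x \<in> R)"

text \<open>
  A Krull domain is an intersection of rank-one discrete valuation rings of its quotient field such
  that every nonzero element is a unit in all but finitely many of them. The family may be empty,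
  so that fields are Krull.
\<close>

definition krull_domain :: "'k::field set \<Rightarrow> bool"
  where "krull_domain R \<longleftrightarrow>
    (\<exists>\<V>. (\<forall>V\<in>\<V>. rank_one_dvr V) \<and> R = \<Inter>\<V> \<and>
      (\<forall>x\<in>R. x \<noteq> 0 \<longrightarrow> finite {V \<in> \<V>. inverse x \<notin> V}))"

definition ufd :: "'k::field set \<Rightarrow> bool"
  where "ufd R \<longleftrightarrow> factorial_domain (as_ring R)"

end

theory Submission
  imports Defs "HOL-Library.Set_Algebras"
begin

text \<open>
  Both equivalences go through one condition: every \<open>t\<close>-ideal \<open>I\<close> is \<open>t\<close>-invertible, that is
  \<open>(I I\<inverse>)\<^sub>t = R\<close>. This condition characterizes Krull domains, and it gives Clifford \<open>t\<close>-regularity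
  at once, since \<open>(I I I\<inverse>)\<^sub>t = I\<close>.

  The heart of the matter is the converse, \<open>clifford_imp_t_invertible\<close>. If \<open>(I I J)\<^sub>t = I\<close>, then
  \<open>B = (I J)\<^sub>t\<close> satisfies \<open>(B B)\<^sub>t = B\<close> and \<open>(I B)\<^sub>t = I\<close>. When \<open>R\<close> is completely integrally closed, a
  field element that maps a \<open>t\<close>-ideal into itself lies in \<open>R\<close>; as \<open>y B \<subseteq> B\<close> for every \<open>y \<in> B\<close>, this
  puts \<open>B\<close> inside \<open>R\<close>. If \<open>B = R\<close>, then \<open>I\<close> is \<open>t\<close>-invertible. Otherwise \<open>B\<close> lies in a \<open>t\<close>-maximal
  ideal \<open>M\<close>. The same dichotomy for \<open>M\<close> makes \<open>M\<close> either \<open>t\<close>-invertible or equal to \<open>(M M)\<^sub>t\<close>, and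
  strong \<open>t\<close>-discreteness excludes the latter. Hence there is \<open>y \<in> M\<inverse>\<close> outside \<open>R\<close>. But \<open>y B \<subseteq> R\<close>, so
  \<open>y B = y (B B)\<^sub>t \<subseteq> (R B)\<^sub>t = B\<close> and \<open>y \<in> R\<close> after all.

  A \<open>t\<close>-almost Dedekind domain is completely integrally closed, because \<open>R\<close> is the intersection of
  its localizations at \<open>t\<close>-maximal ideals, and strongly \<open>t\<close>-discrete, because the value of an element
  of \<open>(P P)\<^sub>t\<close> at a \<open>t\<close>-maximal ideal above \<open>P\<close> is at least twice the least value on \<open>P\<close>. Conversely, if
  all \<open>t\<close>-ideals are \<open>t\<close>-invertible, then the localizations at \<open>t\<close>-maximal ideals are discrete
  valuation rings (\<open>t_invertible_imp_t_almost_dedekind\<close>) and only finitely many \<open>t\<close>-maximal ideals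
  contain a given nonzero element (\<open>t_invertible_imp_finite_character\<close>), so \<open>R\<close> is Krull.

  In the Boolean case \<open>(I I)\<^sub>t = c I\<close>, and multiplication by \<open>I\<inverse>\<close> turns this into \<open>I = c R\<close>. So the
  Boolean conditions say that all \<open>t\<close>-ideals are principal, which is equivalent to unique
  factorization: generators of \<open>t\<close>-ideals play the role of greatest common divisors.
\<close>

section \<open>The \<open>t\<close>-operation on arbitrary subsets of the quotient field\<close>

locale domain_in_field =
  fixes R :: "'k::field set"
  assumes quotient_field: "domain_with_quotient_field R"
begin

lemma subring: "subring R field_ring"
  using quotient_field by (simp add: domain_with_quotient_field_def)

lemma domain_as_ring: "domain (as_ring R)"
proof -
  interpret field "field_ring :: 'k ring" ..
  show ?thesis by (rule subring_is_domain[OF subring])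
qed

lemma zero_in [simp]: "0 \<in> R" and one_in [simp]: "1 \<in> R"
  and add_in: "x \<in> R \<Longrightarrow> y \<in> R \<Longrightarrow> x + y \<in> R"
  and mult_in: "x \<in> R \<Longrightarrow> y \<in> R \<Longrightarrow> x * y \<in> R"
  using subringE[OF subring] by (simp_all add: ring_of_type_algebra_def)

lemma uminus_in: "x \<in> R \<Longrightarrow> - x \<in> R"
proof -
  assume x: "x \<in> R"
  interpret cring "field_ring :: 'k ring" ..
  have "\<ominus>\<^bsub>field_ring\<^esub> x = - x"
    by (rule minus_equality) (simp_all add: ring_of_type_algebra_def)
  then show ?thesis using subringE(5)[OF subring x] by simp
qed

lemma fractionE:
  obtains a b where "a \<in> R" "b \<in> R" "b \<noteq> 0" "x = a / b"
  using quotient_field unfolding domain_with_quotient_field_def by metis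

lemma in_inverse_ideal: "z \<in> inverse_ideal R A \<longleftrightarrow> (\<forall>x\<in>A. z * x \<in> R)"
  by (simp add: inverse_ideal_def colon_def)

lemma in_v_closure: "x \<in> v_closure R A \<longleftrightarrow> (\<forall>z. (\<forall>s\<in>A. z * s \<in> R) \<longrightarrow> x * z \<in> R)"
  by (auto simp: v_closure_def inverse_ideal_def colon_def)

text \<open>
  This is the \<open>t\<close>-operation, with finite sets in place of the finitely generated ideals that they
  generate and with an arbitrary set as argument. It agrees with \<open>t_closure\<close> on nonzero submodules, and
  it does not distinguish the product of two ideals from the mere set \<open>I * J\<close> of products.
\<close>

definition t_hull :: "'k set \<Rightarrow> 'k set"
  where "t_hull A = {x. \<exists>S. finite S \<and> S \<subseteq> A \<and> x \<in> v_closure R S}"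

lemma t_hullI: "finite S \<Longrightarrow> S \<subseteq> A \<Longrightarrow> (\<And>z. (\<And>s. s \<in> S \<Longrightarrow> z * s \<in> R) \<Longrightarrow> x * z \<in> R) \<Longrightarrow> x \<in> t_hull A"
  unfolding t_hull_def mem_Collect_eq in_v_closure by (intro exI[of _ S] conjI allI impI) simp_all

lemma v_closureD: "x \<in> v_closure R S \<Longrightarrow> (\<And>s. s \<in> S \<Longrightarrow> z * s \<in> R) \<Longrightarrow> x * z \<in> R"
  by (simp add: in_v_closure)

lemma t_hullE:
  assumes "x \<in> t_hull A"
  obtains S where "finite S" "S \<subseteq> A" "x \<in> v_closure R S"
  using assms by (auto simp: t_hull_def)

lemma t_hull_superset: "A \<subseteq> t_hull A"
proof
  fix x assume "x \<in> A"
  then show "x \<in> t_hull A"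
    by (intro t_hullI[of "{x}"]) (auto simp: mult.commute)
qed

lemma t_hull_mono: "A \<subseteq> B \<Longrightarrow> t_hull A \<subseteq> t_hull B"
  unfolding t_hull_def by blast

lemma finite_subset_t_hull:
  assumes "finite T" "T \<subseteq> t_hull A"
  shows "\<exists>S. finite S \<and> S \<subseteq> A \<and> T \<subseteq> v_closure R S"
  using assms
proof (induction T)
  case empty
  then show ?case by blast
next
  case (insert x T)
  then obtain S where S: "finite S" "S \<subseteq> A" "T \<subseteq> v_closure R S" by auto
  obtain S' where S': "finite S'" "S' \<subseteq> A" "x \<in> v_closure R S'"
    using insert.prems by (auto simp: t_hull_def)
  show ?case
    by (rule exI[of _ "S \<union> S'"]) (use S S' in \<open>auto simp: in_v_closure subset_iff\<close>)
qed

lemma t_hull_t_hull [simp]: "t_hull (t_hull A) = t_hull A"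
proof
  show "t_hull (t_hull A) \<subseteq> t_hull A"
  proof
    fix x assume "x \<in> t_hull (t_hull A)"
    then obtain T where T: "finite T" "T \<subseteq> t_hull A"
      "x \<in> v_closure R T" by (rule t_hullE)
    obtain S where S: "finite S" "S \<subseteq> A" "T \<subseteq> v_closure R S"
      using finite_subset_t_hull[OF T(1,2)] by blast
    show "x \<in> t_hull A"
    proof (rule t_hullI[OF S(1,2)])
      fix z assume "\<And>s. s \<in> S \<Longrightarrow> z * s \<in> R"
      then have "t * z \<in> R" if "t \<in> T" for t
        using S(3) that by (auto simp: in_v_closure)
      then show "x * z \<in> R" by (intro v_closureD[OF T(3)]) (simp add: mult.commute)
    qed
  qed
qed (rule t_hull_superset)

lemma t_hull_least: "A \<subseteq> t_hull B \<Longrightarrow> t_hull A \<subseteq> t_hull B"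
  using t_hull_mono[of A "t_hull B"] by simp

text \<open>
  If \<open>z S T \<subseteq> R\<close>, then \<open>z T\<close> multiplies \<open>S\<close>, hence the \<open>v\<close>-closure of \<open>S\<close>, into \<open>R\<close>, and the same
  step for \<open>T\<close> finishes. Associativity of the \<open>t\<close>-multiplication follows from this inclusion.
\<close>

lemma t_hull_mult_subset: "t_hull A * t_hull B \<subseteq> t_hull (A * B)"
proof
  fix w assume "w \<in> t_hull A * t_hull B"
  then obtain x y where w: "w = x * y" "x \<in> t_hull A" "y \<in> t_hull B"
    by (auto simp: set_times_def)
  obtain S where S: "finite S" "S \<subseteq> A" "x \<in> v_closure R S"
    using w(2) by (rule t_hullE)
  obtain T where T: "finite T" "T \<subseteq> B" "y \<in> v_closure R T"
    using w(3) by (rule t_hullE)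
  show "w \<in> t_hull (A * B)"
  proof (rule t_hullI)
    show "finite ((\<lambda>(s, t). s * t) ` (S \<times> T))" using S T by blast
    show "(\<lambda>(s, t). s * t) ` (S \<times> T) \<subseteq> A * B" using S T by (auto simp: set_times_def)
    fix z assume z: "\<And>u. u \<in> (\<lambda>(s, t). s * t) ` (S \<times> T) \<Longrightarrow> z * u \<in> R"
    have "(x * z) * t \<in> R" if "t \<in> T" for t
    proof -
      have "x * (z * t) \<in> R"
      proof (rule v_closureD[OF S(3)])
        fix s assume "s \<in> S"
        then have "z * (s * t) \<in> R" using z that by auto
        then show "z * t * s \<in> R" by (simp add: ac_simps)
      qed
      then show ?thesis by (simp add: ac_simps)
    qed
    then have "y * (x * z) \<in> R" by (rule v_closureD[OF T(3)])
    then show "w * z \<in> R" by (simp add: w ac_simps)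
  qed
qed

lemma t_hull_mult_left [simp]: "t_hull (t_hull A * B) = t_hull (A * B)"
proof
  have "t_hull A * B \<subseteq> t_hull (A * B)"
    using t_hull_mult_subset[of A B] t_hull_superset[of B] by (auto simp: set_times_def)
  then show "t_hull (t_hull A * B) \<subseteq> t_hull (A * B)" by (rule t_hull_least)
  show "t_hull (A * B) \<subseteq> t_hull (t_hull A * B)"
    by (intro t_hull_mono set_times_mono2 t_hull_superset) auto
qed

lemma t_hull_mult_right [simp]: "t_hull (A * t_hull B) = t_hull (A * B)"
  by (metis t_hull_mult_left mult.commute)

lemma zero_in_t_hull [simp]: "0 \<in> t_hull A"
  by (rule t_hullI[of "{}"]) auto

lemma add_in_t_hull:
  assumes "x \<in> t_hull A" "y \<in> t_hull A"
  shows "x + y \<in> t_hull A"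
proof -
  have "finite {x, y}" "{x, y} \<subseteq> t_hull A" using assms by auto
  then have "x + y \<in> t_hull (t_hull A)"
  proof (rule t_hullI)
    fix z assume "\<And>s. s \<in> {x, y} \<Longrightarrow> z * s \<in> R"
    then have "z * x + z * y \<in> R" by (intro add_in) auto
    then show "(x + y) * z \<in> R" by (simp add: algebra_simps)
  qed
  then show ?thesis by simp
qed

lemma scale_in_t_hull:
  assumes "r \<in> R" "x \<in> t_hull A"
  shows "r * x \<in> t_hull A"
proof -
  have "finite {x}" "{x} \<subseteq> t_hull A" using assms by auto
  then have "r * x \<in> t_hull (t_hull A)"
  proof (rule t_hullI)
    fix z assume "\<And>s. s \<in> {x} \<Longrightarrow> z * s \<in> R"
    then have "r * (z * x) \<in> R" by (intro mult_in[OF assms(1)]) auto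
    then show "r * x * z \<in> R" by (simp add: ac_simps)
  qed
  then show ?thesis by simp
qed

lemma t_hull_R [simp]: "t_hull R = R"
proof
  show "t_hull R \<subseteq> R"
  proof
    fix x assume "x \<in> t_hull R"
    then obtain S where "S \<subseteq> R" "x \<in> v_closure R S"
      by (rule t_hullE)
    from v_closureD[OF this(2), of 1] this(1) show "x \<in> R" by auto
  qed
qed (rule t_hull_superset)

lemma t_hull_subset_R: "A \<subseteq> R \<Longrightarrow> t_hull A \<subseteq> R"
  using t_hull_mono[of A R] by simp

lemma t_hull_inverse_ideal [simp]: "t_hull (inverse_ideal R A) = inverse_ideal R A"
proof
  show "t_hull (inverse_ideal R A) \<subseteq> inverse_ideal R A"
  proof
    fix x assume "x \<in> t_hull (inverse_ideal R A)"
    then obtain S where S: "S \<subseteq> inverse_ideal R A"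
      "x \<in> v_closure R S" by (rule t_hullE)
    show "x \<in> inverse_ideal R A"
      unfolding in_inverse_ideal
    proof
      fix y assume "y \<in> A"
      with S(1) show "x * y \<in> R" by (intro v_closureD[OF S(2)]) (auto simp: in_inverse_ideal mult.commute)
    qed
  qed
qed (rule t_hull_superset)

lemma image_eq_singleton_mult: "(*) c ` A = {c} * (A :: 'k set)"
  by (auto simp: set_times_def)

lemma singleton_mult_cancel: "c \<noteq> 0 \<Longrightarrow> {inverse c} * ({c} * A) = (A :: 'k set)"
  "c \<noteq> 0 \<Longrightarrow> {c} * ({inverse c} * A) = (A :: 'k set)"
  by (simp_all flip: image_eq_singleton_mult add: image_image mult.assoc[symmetric])

lemma in_singleton_mult: "c \<noteq> 0 \<Longrightarrow> x \<in> {c} * A \<longleftrightarrow> x / c \<in> (A :: 'k set)"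
  by (auto simp: set_times_def intro: bexI[of _ "x / c"])

lemma t_hull_singleton_mult:
  assumes "c \<noteq> 0"
  shows "t_hull ({c} * A) = {c} * t_hull A"
proof
  have le: "{d} * t_hull B \<subseteq> t_hull ({d} * B)" for d B
    using t_hull_mult_subset[of "{d}" B] t_hull_superset[of "{d}"] by (auto simp: set_times_def)
  then show "{c} * t_hull A \<subseteq> t_hull ({c} * A)" .
  have "{inverse c} * t_hull ({c} * A) \<subseteq> t_hull A"
    using le[of "inverse c" "{c} * A"] by (simp add: singleton_mult_cancel assms)
  then have "{c} * ({inverse c} * t_hull ({c} * A)) \<subseteq> {c} * t_hull A"
    by (intro set_times_mono2) auto
  then show "t_hull ({c} * A) \<subseteq> {c} * t_hull A" by (simp add: singleton_mult_cancel assms)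
qed

lemma common_denominator:
  assumes "finite S"
  shows "\<exists>d\<in>R. d \<noteq> 0 \<and> (\<forall>s\<in>S. d * s \<in> R)"
  using assms
proof (induction S)
  case empty
  show ?case by (rule bexI[of _ 1]) auto
next
  case (insert x S)
  then obtain d where d: "d \<in> R" "d \<noteq> 0" "\<forall>s\<in>S. d * s \<in> R" by auto
  obtain a b where ab: "a \<in> R" "b \<in> R" "b \<noteq> 0" "x = a / b" by (rule fractionE)
  have "d * b * s \<in> R" if "s \<in> S" for s
    using mult_in[OF ab(2), of "d * s"] d that by (simp add: ac_simps)
  moreover have "d * b * x \<in> R" using ab d by (simp add: mult_in)
  ultimately show ?case using d ab by (intro bexI[of _ "d * b"]) (auto intro: mult_in)
qed

definition submodule :: "'k set \<Rightarrow> bool"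
  where "submodule A \<longleftrightarrow>
    0 \<in> A \<and> (\<forall>x\<in>A. \<forall>y\<in>A. x + y \<in> A) \<and> (\<forall>r\<in>R. \<forall>x\<in>A. r * x \<in> A)"

lemma submodule_t_hull: "submodule (t_hull A)"
  by (simp add: submodule_def add_in_t_hull scale_in_t_hull)

lemma submodule_colon: "submodule {x. z * x \<in> R}"
  unfolding submodule_def
proof (intro conjI ballI)
  show "r * x \<in> {x. z * x \<in> R}" if "r \<in> R" "x \<in> {x. z * x \<in> R}" for r x
    using mult_in[OF that(1), of "z * x"] that(2) by (simp add: ac_simps)
qed (auto simp: distrib_left intro: add_in)

definition generated :: "'k set \<Rightarrow> 'k set"
  where "generated S = {\<Sum>s\<in>S. r s * s | r. \<forall>s\<in>S. r s \<in> R}"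

lemma generators_subset: "finite S \<Longrightarrow> S \<subseteq> generated S"
proof
  fix s assume "finite S" "s \<in> S"
  then have "s = (\<Sum>u\<in>S. (if u = s then 1 else 0) * u)"
    by (simp add: if_distrib[of "\<lambda>c. c * _"] cong: if_cong)
  then show "s \<in> generated S"
    unfolding generated_def by (auto intro!: exI[of _ "\<lambda>u. if u = s then 1 else 0"])
qed

lemma generated_least:
  assumes "submodule B" "S \<subseteq> B"
  shows "generated S \<subseteq> B"
proof -
  have "(\<Sum>s\<in>T. r s * s) \<in> B" if "T \<subseteq> S" "\<forall>s\<in>S. r s \<in> R" for T r
    using that(1)
    by (induction T rule: infinite_finite_induct)
      (use that(2) assms in \<open>auto simp: submodule_def\<close>)
  then show ?thesis by (auto simp: generated_def)
qed

lemma submodule_generated: "submodule (generated S)"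
  unfolding submodule_def
proof (intro conjI ballI)
  show "0 \<in> generated S" unfolding generated_def by (auto intro!: exI[of _ "\<lambda>_. 0"])
  show "a + b \<in> generated S" if ab: "a \<in> generated S" "b \<in> generated S" for a b
  proof -
    obtain r where "a = (\<Sum>s\<in>S. r s * s)" "\<forall>s\<in>S. r s \<in> R"
      using ab(1) unfolding generated_def by blast
    moreover obtain r' where "b = (\<Sum>s\<in>S. r' s * s)" "\<forall>s\<in>S. r' s \<in> R"
      using ab(2) unfolding generated_def by blast
    ultimately show ?thesis unfolding generated_def
      by (auto intro!: exI[of _ "\<lambda>s. r s + r' s"] add_in simp: distrib_right sum.distrib)
  qed
  show "c * a \<in> generated S" if ca: "c \<in> R" "a \<in> generated S" for a c
  proof -
    obtain r where "a = (\<Sum>s\<in>S. r s * s)" "\<forall>s\<in>S. r s \<in> R"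
      using ca(2) unfolding generated_def by blast
    then show ?thesis unfolding generated_def
      by (auto intro!: exI[of _ "\<lambda>s. c * r s"] mult_in[OF ca(1)]
          simp: sum_distrib_left mult.assoc)
  qed
qed

lemma v_closure_generated: "finite S \<Longrightarrow> v_closure R (generated S) = v_closure R S"
proof -
  assume "finite S"
  then have "(\<forall>s\<in>generated S. z * s \<in> R) \<longleftrightarrow> (\<forall>s\<in>S. z * s \<in> R)" for z
    using generators_subset[of S] generated_least[OF submodule_colon[of z], of S] by auto
  then show ?thesis by (simp add: set_eq_iff in_v_closure)
qed

lemma t_closure_eq_t_hull:
  assumes A: "submodule A" "A \<noteq> {0}"
  shows "t_closure R A = t_hull A"
proof
  show "t_closure R A \<subseteq> t_hull A"
  proof
    fix x assume "x \<in> t_closure R A"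
    then obtain S where S: "finite S" "generated S \<subseteq> A" "x \<in> v_closure R (generated S)"
      by (auto simp: t_closure_def finitely_generated_def generated_def[symmetric])
    then show "x \<in> t_hull A"
      using generators_subset[of S] by (auto simp: t_hull_def v_closure_generated)
  qed
  show "t_hull A \<subseteq> t_closure R A"
  proof
    fix x assume "x \<in> t_hull A"
    then obtain S0 where S0: "finite S0" "S0 \<subseteq> A" "x \<in> v_closure R S0" by (rule t_hullE)
    (* The finitely generated ideals in the definition are nonzero, whereas S0 may be empty. *)
    obtain e where e: "e \<in> A" "e \<noteq> 0" using A by (auto simp: submodule_def)
    define S where "S = insert e S0"
    have S: "finite S" "S \<subseteq> A" "x \<in> v_closure R S"
      using S0 e by (auto simp: S_def in_v_closure)
    obtain d where d: "d \<in> R" "d \<noteq> 0" "\<forall>s\<in>S. d * s \<in> R"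
      using common_denominator[OF S(1)] by blast
    then have "\<forall>x\<in>generated S. d * x \<in> R"
      using generated_least[OF submodule_colon[of d], of S] by auto
    then have "fractional_ideal R (generated S)"
      using submodule_generated[of S] d by (auto simp: fractional_ideal_def submodule_def)
    moreover have "generated S \<noteq> {0}" using generators_subset[OF S(1)] e by (auto simp: S_def)
    moreover have "finitely_generated R (generated S)"
      unfolding finitely_generated_def generated_def using S(1) by blast
    moreover have "generated S \<subseteq> A" using generated_least[OF A(1) S(2)] .
    moreover have "x \<in> v_closure R (generated S)" using S by (simp add: v_closure_generated)
    ultimately show "x \<in> t_closure R A" by (auto simp: t_closure_def)
  qed
qed

lemma t_ideal_iff:
  "t_ideal R I \<longleftrightarrow> t_hull I = I \<and> I \<noteq> {0} \<and> (\<exists>d\<in>R. d \<noteq> 0 \<and> (\<forall>x\<in>I. d * x \<in> R))"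
proof
  assume "t_ideal R I"
  then have I: "fractional_ideal R I" "I \<noteq> {0}" "t_closure R I = I" by (auto simp: t_ideal_def)
  then have "submodule I" by (auto simp: fractional_ideal_def submodule_def)
  then show "t_hull I = I \<and> I \<noteq> {0} \<and> (\<exists>d\<in>R. d \<noteq> 0 \<and> (\<forall>x\<in>I. d * x \<in> R))"
    using I t_closure_eq_t_hull[of I] by (auto simp: fractional_ideal_def)
next
  assume I: "t_hull I = I \<and> I \<noteq> {0} \<and> (\<exists>d\<in>R. d \<noteq> 0 \<and> (\<forall>x\<in>I. d * x \<in> R))"
  then have "submodule I" using submodule_t_hull[of I] by simp
  then show "t_ideal R I"
    using I t_closure_eq_t_hull[of I] by (auto simp: t_ideal_def fractional_ideal_def submodule_def)
qed

lemma t_ideal_t_hull: "t_ideal R I \<Longrightarrow> t_hull I = I"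
  by (simp add: t_ideal_iff)

lemma t_ideal_submodule: "t_ideal R I \<Longrightarrow> submodule I"
  using submodule_t_hull[of I] by (simp add: t_ideal_iff)

lemma t_ideal_nonzeroE:
  assumes "t_ideal R I"
  obtains x where "x \<in> I" "x \<noteq> 0"
  using assms t_ideal_submodule[OF assms] by (auto simp: t_ideal_iff submodule_def)

lemma t_ideal_boundedE:
  assumes "t_ideal R I"
  obtains d where "d \<in> R" "d \<noteq> 0" "\<forall>x\<in>I. d * x \<in> R"
  using assms by (auto simp: t_ideal_iff)

lemma t_ideal_add: "t_ideal R I \<Longrightarrow> x \<in> I \<Longrightarrow> y \<in> I \<Longrightarrow> x + y \<in> I"
  and t_ideal_scale: "t_ideal R I \<Longrightarrow> r \<in> R \<Longrightarrow> x \<in> I \<Longrightarrow> r * x \<in> I"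
  and t_ideal_zero: "t_ideal R I \<Longrightarrow> 0 \<in> I"
  using t_ideal_submodule[of I] by (auto simp: submodule_def)

lemma t_ideal_scale_right: "t_ideal R I \<Longrightarrow> x \<in> I \<Longrightarrow> r \<in> R \<Longrightarrow> x * r \<in> I"
  by (metis t_ideal_scale mult.commute)

lemma t_hull_subset_t_ideal: "t_ideal R I \<Longrightarrow> A \<subseteq> I \<Longrightarrow> t_hull A \<subseteq> I"
  using t_hull_mono[of A I] by (simp add: t_ideal_t_hull)

lemma t_ideal_t_hullI:
  assumes "x \<in> A" "x \<noteq> 0" and d: "d \<in> R" "d \<noteq> 0" "\<And>x. x \<in> A \<Longrightarrow> d * x \<in> R"
  shows "t_ideal R (t_hull A)"
  unfolding t_ideal_iff
proof (intro conjI)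
  show "t_hull A \<noteq> {0}" using assms t_hull_superset by blast
  have "A \<subseteq> inverse_ideal R {d}" using d by (auto simp: in_inverse_ideal mult.commute)
  then have "t_hull A \<subseteq> inverse_ideal R {d}" using t_hull_mono[of A "inverse_ideal R {d}"] by simp
  then show "\<exists>d\<in>R. d \<noteq> 0 \<and> (\<forall>x\<in>t_hull A. d * x \<in> R)"
    using d(1,2) by (intro bexI[of _ d]) (auto simp: in_inverse_ideal mult.commute)
qed simp

lemma t_ideal_subset_R_I:
  assumes "t_hull I = I" "I \<subseteq> R" "x \<in> I" "x \<noteq> 0"
  shows "t_ideal R I"
  using t_ideal_t_hullI[of x I 1] assms by auto

lemma t_ideal_R: "t_ideal R R"
  by (rule t_ideal_subset_R_I[of _ 1]) auto

lemma t_ideal_eq_R: "t_ideal R I \<Longrightarrow> I \<subseteq> R \<Longrightarrow> 1 \<in> I \<Longrightarrow> I = R"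
  using t_ideal_scale[of I _ 1] by auto

lemma t_ideal_mult:
  assumes "t_ideal R I" "t_ideal R J"
  shows "t_ideal R (t_hull (I * J))"
proof -
  obtain x y where x: "x \<in> I" "x \<noteq> 0" and y: "y \<in> J" "y \<noteq> 0"
    using assms by (metis t_ideal_nonzeroE)
  obtain d where d: "d \<in> R" "d \<noteq> 0" "\<forall>x\<in>I. d * x \<in> R"
    using assms(1) by (rule t_ideal_boundedE)
  obtain e where e: "e \<in> R" "e \<noteq> 0" "\<forall>x\<in>J. e * x \<in> R"
    using assms(2) by (rule t_ideal_boundedE)
  show ?thesis
  proof (rule t_ideal_t_hullI)
    show "x * y \<in> I * J" "x * y \<noteq> 0" "d * e \<in> R" "d * e \<noteq> 0" using x y d e by (auto intro: mult_in)
    show "d * e * w \<in> R" if "w \<in> I * J" for w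
    proof -
      obtain a b where w: "w = a * b" "a \<in> I" "b \<in> J" using \<open>w \<in> I * J\<close> by (auto simp: set_times_def)
      then have "(d * a) * (e * b) \<in> R" using d e by (auto intro!: mult_in[of "d * a" "e * b"])
      then show ?thesis by (simp add: w ac_simps)
    qed
  qed
qed

lemma t_ideal_inverse_ideal:
  assumes "t_ideal R I"
  shows "t_ideal R (inverse_ideal R I)"
proof -
  obtain d where d: "d \<in> R" "d \<noteq> 0" "\<forall>x\<in>I. d * x \<in> R"
    using assms(1) by (rule t_ideal_boundedE)
  obtain x where x: "x \<in> I" "x \<noteq> 0" using assms(1) by (rule t_ideal_nonzeroE)
  obtain a b where ab: "a \<in> R" "b \<in> R" "b \<noteq> 0" "x = a / b" by (rule fractionE)
  have "b * x \<in> I" using t_ideal_scale[OF assms ab(2) x(1)] .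
  then have aI: "a \<in> I" using ab by simp
  have "t_ideal R (t_hull (inverse_ideal R I))"
    by (rule t_ideal_t_hullI[of d _ a])
      (use d aI ab x in \<open>auto simp: in_inverse_ideal mult.commute\<close>)
  then show ?thesis by simp
qed

lemma R_mult_t_ideal: "t_ideal R I \<Longrightarrow> R * I = I"
proof
  assume I: "t_ideal R I"
  then show "R * I \<subseteq> I" by (auto simp: set_times_def t_ideal_scale)
  have "1 * x \<in> R * I" if "x \<in> I" for x using that by (intro set_times_intro) auto
  then show "I \<subseteq> R * I" by auto
qed

lemma t_ideal_singleton_mult:
  assumes "t_ideal R I" "c \<noteq> 0"
  shows "t_ideal R ({c} * I)"
proof -
  obtain a b where ab: "a \<in> R" "b \<in> R" "b \<noteq> 0" "c = a / b" by (rule fractionE)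
  obtain d where d: "d \<in> R" "d \<noteq> 0" "\<forall>x\<in>I. d * x \<in> R"
    using assms(1) by (rule t_ideal_boundedE)
  obtain x where x: "x \<in> I" "x \<noteq> 0" using assms(1) by (rule t_ideal_nonzeroE)
  have "t_ideal R (t_hull ({c} * I))"
  proof (rule t_ideal_t_hullI)
    show "c * x \<in> {c} * I" "c * x \<noteq> 0" using x assms by auto
    show "b * d \<in> R" "b * d \<noteq> 0" using ab d by (auto intro: mult_in)
    show "b * d * w \<in> R" if "w \<in> {c} * I" for w
    proof -
      obtain y where "w = c * y" "y \<in> I" using \<open>w \<in> {c} * I\<close> by (auto simp: set_times_def)
      moreover have "a * (d * y) \<in> R" using ab(1) d(3) \<open>y \<in> I\<close> by (auto intro!: mult_in[of a "d * y"])
      ultimately show ?thesis using ab by (simp add: ac_simps)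
    qed
  qed
  then show ?thesis using assms by (simp add: t_hull_singleton_mult t_ideal_t_hull)
qed

lemma t_closure_mult:
  assumes "t_ideal R I" "t_ideal R J"
  shows "t_closure R (I \<cdot>\<^bsub>field_ring\<^esub> J) = t_hull (I * J)"
proof -
  let ?P = "I \<cdot>\<^bsub>field_ring\<^esub> J"
  have in1: "I * J \<subseteq> ?P"
    using ideal_prod.prod[of _ I _ J "field_ring"] by (auto simp: set_times_def ring_of_type_algebra_def)
  have in2: "?P \<subseteq> t_hull (I * J)"
  proof
    fix x assume "x \<in> ?P"
    then show "x \<in> t_hull (I * J)"
    proof induction
      case (prod i j)
      then show ?case using t_hull_superset[of "I * J"] by (auto simp: ring_of_type_algebra_def)
    next
      case (sum s1 s2)
      then show ?case using add_in_t_hull by (simp add: ring_of_type_algebra_def)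
    qed
  qed
  obtain x y where x: "x \<in> I" "x \<noteq> 0" and y: "y \<in> J" "y \<noteq> 0"
    using assms by (metis t_ideal_nonzeroE)
  have "x * y \<in> ?P" using x(1) y(1) in1 by blast
  moreover have "x * y \<noteq> 0" using x(2) y(2) by simp
  ultimately have "?P \<noteq> {0}" by blast
  moreover have "submodule ?P"
    unfolding submodule_def
  proof (intro conjI ballI)
    have "0 * 0 \<in> I * J"
      using t_ideal_zero[OF assms(1)] t_ideal_zero[OF assms(2)] by (intro set_times_intro)
    then show "0 \<in> ?P" using in1 by auto
    show "x + y \<in> ?P" if "x \<in> ?P" "y \<in> ?P" for x y
      using ideal_prod.sum[OF that] by (simp add: ring_of_type_algebra_def)
    show "r * x \<in> ?P" if "r \<in> R" "x \<in> ?P" for r x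
      using that(2)
    proof induction
      case (prod i j)
      then have "(r * i) * j \<in> I * J" using t_ideal_scale[OF assms(1) that(1)] by auto
      then show ?case using in1 by (auto simp: ring_of_type_algebra_def mult.assoc)
    next
      case (sum s1 s2)
      then show ?case using ideal_prod.sum[of "r * s1" field_ring I J "r * s2"]
        by (simp add: ring_of_type_algebra_def distrib_left)
    qed
  qed
  ultimately have "t_closure R ?P = t_hull ?P" by (intro t_closure_eq_t_hull)
  moreover have "t_hull ?P = t_hull (I * J)"
    using t_hull_mono[OF in1] t_hull_least[OF in2] by blast
  ultimately show ?thesis by simp
qed

section \<open>The \<open>t\<close>-class semigroup\<close>

definition t_class :: "'k set \<Rightarrow> 'k set set"
  where "t_class I = {{c} * I | c. c \<noteq> 0}"

lemma t_class_refl: "I \<in> t_class I"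
  unfolding t_class_def by (rule CollectI, rule exI[of _ 1]) (simp flip: set_one)

lemma singleton_mult_singleton: "{c} * ({d} * A) = {c * d} * (A :: 'k set)"
  by (simp flip: image_eq_singleton_mult add: image_image mult.assoc)

lemma t_class_singleton_mult:
  assumes "c \<noteq> 0"
  shows "t_class ({c} * I) = t_class I"
proof
  show "t_class ({c} * I) \<subseteq> t_class I"
    using assms by (force simp: t_class_def singleton_mult_singleton)
  show "t_class I \<subseteq> t_class ({c} * I)"
  proof
    fix A assume "A \<in> t_class I"
    then obtain d where d: "d \<noteq> 0" "A = {d} * I" by (auto simp: t_class_def)
    then have "A = {d * inverse c} * ({c} * I)"
      using assms by (simp add: singleton_mult_singleton mult.assoc)
    then show "A \<in> t_class ({c} * I)" using assms d unfolding t_class_def by fastforce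
  qed
qed

lemma t_class_eq_iff: "t_class I = t_class J \<longleftrightarrow> (\<exists>c. c \<noteq> 0 \<and> I = {c} * J)"
proof
  assume "t_class I = t_class J"
  then have "I \<in> t_class J" using t_class_refl by blast
  then show "\<exists>c. c \<noteq> 0 \<and> I = {c} * J" by (auto simp: t_class_def)
qed (auto simp: t_class_singleton_mult)

lemma coset_eq_t_class:
  assumes "t_ideal R I"
  shows "principal_ideals R #>\<^bsub>t_ideal_monoid R\<^esub> I = t_class I"
proof -
  have "t_closure R (((*) c ` R) \<cdot>\<^bsub>field_ring\<^esub> I) = {c} * I" if "c \<noteq> 0" for c
    using t_closure_mult[OF t_ideal_singleton_mult[OF t_ideal_R that] assms] assms that
    by (simp add: image_eq_singleton_mult t_hull_singleton_mult R_mult_t_ideal t_ideal_t_hull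
        mult.assoc)
  then show ?thesis
    unfolding r_coset_def principal_ideals_def t_ideal_monoid_def t_class_def by auto
qed

lemma carrier_t_class_semigroup: "carrier (t_class_semigroup R) = t_class ` {I. t_ideal R I}"
proof -
  have "carrier (t_class_semigroup R) =
      (\<lambda>I. principal_ideals R #>\<^bsub>t_ideal_monoid R\<^esub> I) ` {I. t_ideal R I}"
    unfolding t_class_semigroup_def by (simp add: carrier_FactGroup t_ideal_monoid_def)
  also have "\<dots> = t_class ` {I. t_ideal R I}"
    by (intro image_cong) (auto simp: coset_eq_t_class)
  finally show ?thesis .
qed

lemma t_class_mult:
  assumes "t_ideal R I" "t_ideal R J"
  shows "t_class I \<otimes>\<^bsub>t_class_semigroup R\<^esub> t_class J = t_class (t_hull (I * J))"
proof -
  have eq: "t_closure R (({c} * I) \<cdot>\<^bsub>field_ring\<^esub> ({d} * J)) = {c * d} * t_hull (I * J)"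
    if "c \<noteq> 0" "d \<noteq> 0" for c d
  proof -
    have "({c} * I) * ({d} * J) = ({c} * {d}) * (I * J)" by (simp only: ac_simps)
    also have "\<dots> = {c * d} * (I * J)" by (simp add: set_times_def)
    finally show ?thesis
      using t_closure_mult[OF t_ideal_singleton_mult[OF assms(1) that(1)]
          t_ideal_singleton_mult[OF assms(2) that(2)]] that
      by (simp add: t_hull_singleton_mult)
  qed
  have "t_class I \<otimes>\<^bsub>t_class_semigroup R\<^esub> t_class J =
      {t_closure R (({c} * I) \<cdot>\<^bsub>field_ring\<^esub> ({d} * J)) | c d. c \<noteq> 0 \<and> d \<noteq> 0}"
    unfolding t_class_semigroup_def mult_FactGroup set_mult_def
    by (auto simp: t_ideal_monoid_def t_class_def)
  also have "\<dots> = {{c * d} * t_hull (I * J) | c d. c \<noteq> 0 \<and> d \<noteq> 0}"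
    using eq by (intro Collect_cong) metis
  also have "\<dots> = t_class (t_hull (I * J))"
  proof
    show "t_class (t_hull (I * J)) \<subseteq> {{c * d} * t_hull (I * J) | c d. c \<noteq> 0 \<and> d \<noteq> 0}"
      unfolding t_class_def by (smt (verit) Collect_mono mult.right_neutral one_neq_zero)
    show "{{c * d} * t_hull (I * J) | c d. c \<noteq> 0 \<and> d \<noteq> 0} \<subseteq> t_class (t_hull (I * J))"
      unfolding t_class_def by auto
  qed
  finally show ?thesis .
qed

lemma clifford_t_regular_iff:
  "clifford_t_regular R \<longleftrightarrow>
    (\<forall>I. t_ideal R I \<longrightarrow> (\<exists>J. t_ideal R J \<and> t_hull (I * I * J) = I))"
proof -
  have *: "(\<exists>J. t_ideal R J \<and> (t_class I \<otimes>\<^bsub>t_class_semigroup R\<^esub> t_class I)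
        \<otimes>\<^bsub>t_class_semigroup R\<^esub> t_class J = t_class I) \<longleftrightarrow>
      (\<exists>J. t_ideal R J \<and> t_hull (I * I * J) = I)" (is "?L \<longleftrightarrow> ?R") if I: "t_ideal R I" for I
  proof
    assume ?L
    then obtain J where J: "t_ideal R J" "t_class (t_hull (I * I * J)) = t_class I"
      using I by (auto simp: t_class_mult t_ideal_mult)
    then obtain c where c: "c \<noteq> 0" "t_hull (I * I * J) = {c} * I" by (auto simp: t_class_eq_iff)
    (* The factor c is absorbed into J. *)
    have "t_hull (I * I * ({inverse c} * J)) = t_hull ({inverse c} * (I * I * J))"
      by (simp only: ac_simps)
    also have "\<dots> = I" using c by (simp add: t_hull_singleton_mult singleton_mult_cancel)
    finally show ?R using t_ideal_singleton_mult[OF J(1), of "inverse c"] c by auto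
  next
    assume ?R
    then obtain J where J: "t_ideal R J" "t_hull (I * I * J) = I" by blast
    then show ?L using I by (intro exI[of _ J]) (simp add: t_class_mult t_ideal_mult)
  qed
  then show ?thesis
    unfolding clifford_t_regular_def clifford_semigroup_def carrier_t_class_semigroup by auto
qed

lemma boole_t_regular_iff:
  "boole_t_regular R \<longleftrightarrow> (\<forall>I. t_ideal R I \<longrightarrow> (\<exists>c. c \<noteq> 0 \<and> t_hull (I * I) = {c} * I))"
  unfolding boole_t_regular_def boolean_semigroup_def carrier_t_class_semigroup
  by (auto simp: t_class_mult t_class_eq_iff)

lemma boole_imp_clifford:
  assumes "boole_t_regular R"
  shows "clifford_t_regular R"
  using assms
  unfolding boole_t_regular_def boolean_semigroup_def clifford_t_regular_def clifford_semigroup_def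
  by auto

section \<open>\<open>t\<close>-maximal ideals and localization\<close>

lemma t_maximal_t_ideal: "t_maximal R M \<Longrightarrow> t_ideal R M"
  and t_maximal_subset: "t_maximal R M \<Longrightarrow> M \<subseteq> R"
  by (auto simp: t_maximal_def)

lemma one_notin_t_maximal: "t_maximal R M \<Longrightarrow> 1 \<notin> M"
  using t_ideal_eq_R[of M] by (auto simp: t_maximal_def)

text \<open>
  Membership in a \<open>t\<close>-closure only involves finitely many elements, so the union of a chain of
  \<open>t\<close>-closed sets is \<open>t\<close>-closed and Zorn's lemma applies.
\<close>

lemma ex_t_maximal:
  assumes I: "t_ideal R I" "I \<subseteq> R" "1 \<notin> I"
  obtains M where "t_maximal R M" "I \<subseteq> M"
proof -
  let ?F = "{N. t_hull N = N \<and> N \<subseteq> R \<and> 1 \<notin> N \<and> I \<subseteq> N}"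
  obtain x where x: "x \<in> I" "x \<noteq> 0" using I(1) by (rule t_ideal_nonzeroE)
  have "I \<in> ?F" using I by (auto simp: t_ideal_t_hull)
  have "\<exists>M\<in>?F. \<forall>N\<in>?F. M \<subseteq> N \<longrightarrow> N = M"
  proof (rule subset_Zorn_nonempty)
    show "?F \<noteq> {}" using \<open>I \<in> ?F\<close> by blast
    fix C assume C: "C \<noteq> {}" "subset.chain ?F C"
    have CF: "C \<subseteq> ?F" using C(2) by (auto simp: subset.chain_def)
    have "t_hull (\<Union>C) \<subseteq> \<Union>C"
    proof
      fix y assume "y \<in> t_hull (\<Union>C)"
      then obtain S where S: "finite S" "S \<subseteq> \<Union>C" "y \<in> v_closure R S" by (rule t_hullE)
      obtain N where N: "N \<in> C" "S \<subseteq> N"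
        using finite_subset_Union_chain[OF S(1,2) C] by blast
      then have "y \<in> t_hull N" using S by (auto simp: t_hull_def)
      then show "y \<in> \<Union>C" using N CF by blast
    qed
    then have "t_hull (\<Union>C) = \<Union>C" using t_hull_superset by blast
    moreover have "I \<subseteq> \<Union>C" using CF C(1) by blast
    moreover have "\<Union>C \<subseteq> R" "1 \<notin> \<Union>C" using CF by blast+
    ultimately show "\<Union>C \<in> ?F" by simp
  qed
  then obtain M where M: "M \<in> ?F" "\<forall>N\<in>?F. M \<subseteq> N \<longrightarrow> N = M" by (rule bexE)
  have "t_maximal R M"
    unfolding t_maximal_def
  proof (intro conjI allI impI)
    show "t_ideal R M" using M(1) x by (intro t_ideal_subset_R_I[of M x]) auto
    show "M \<subset> R" using M(1) one_in by blast
    fix N assume N: "t_ideal R N \<and> N \<subset> R \<and> M \<subseteq> N"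
    then have "1 \<notin> N" using t_ideal_eq_R[of N] by blast
    then have "N \<in> ?F" using N M(1) by (auto simp: t_ideal_t_hull)
    then show "N = M" using N M(2) by simp
  qed
  then show thesis using M(1) that by blast
qed

text \<open>
  If \<open>M\<close> is \<open>t\<close>-maximal and \<open>a \<notin> M\<close> then \<open>1\<close> lies in the \<open>t\<close>-closure of \<open>M \<union> {a}\<close>; multiplying by \<open>b\<close>
  puts \<open>b\<close> into \<open>M\<close> as soon as \<open>ab \<in> M\<close>.
\<close>

lemma t_maximal_prime:
  assumes M: "t_maximal R M" and ab: "a \<in> R" "b \<in> R" "a * b \<in> M"
  shows "a \<in> M \<or> b \<in> M"
proof (rule ccontr)
  assume "\<not> (a \<in> M \<or> b \<in> M)"
  then have "a \<notin> M" "b \<notin> M" by auto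
  let ?N = "t_hull (insert a M)"
  note tM = t_maximal_t_ideal[OF M] and MR = t_maximal_subset[OF M]
  obtain x where x: "x \<in> M" "x \<noteq> 0" using tM by (rule t_ideal_nonzeroE)
  have NR: "?N \<subseteq> R" using ab MR by (intro t_hull_subset_R) auto
  have N: "insert a M \<subseteq> ?N" by (rule t_hull_superset)
  have "t_ideal R ?N" using x N by (intro t_ideal_subset_R_I[OF _ NR, of x]) auto
  then have "\<not> ?N \<subset> R" using M N \<open>a \<notin> M\<close> by (auto simp: t_maximal_def)
  then have "1 \<in> ?N" using NR one_in by blast
  then have "b * 1 \<in> t_hull ({b} * insert a M)"
    using t_hull_mult_subset[of "{b}" "insert a M"] t_hull_superset[of "{b}"] by blast
  moreover have "{b} * insert a M \<subseteq> M"
    using ab t_ideal_scale[OF tM] by (auto simp: set_times_def mult.commute[of b a])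
  ultimately show False using \<open>b \<notin> M\<close> t_hull_subset_t_ideal[OF tM] by auto
qed

lemma t_maximal_t_prime:
  assumes M: "t_maximal R M"
  shows "t_prime R M"
proof -
  note tM = t_maximal_t_ideal[OF M] and MR = t_maximal_subset[OF M]
  interpret A: domain "as_ring R" by (rule domain_as_ring)
  have "ideal M (as_ring R)"
  proof (rule idealI)
    show "subgroup M (add_monoid (as_ring R))"
    proof (rule A.add.subgroupI)
      show "\<ominus>\<^bsub>as_ring R\<^esub> a \<in> M" if "a \<in> M" for a
      proof -
        have "\<ominus>\<^bsub>as_ring R\<^esub> a = - a"
          using that MR by (intro A.minus_equality) (auto simp: ring_of_type_algebra_def uminus_in)
        then show ?thesis using t_ideal_scale[OF tM, of "- 1" a] that by (simp add: uminus_in)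
      qed
    qed (use t_ideal_zero[OF tM] MR t_ideal_add[OF tM] in \<open>auto simp: ring_of_type_algebra_def\<close>)
  qed (use t_ideal_scale[OF tM] t_ideal_scale_right[OF tM] A.ring_axioms in
      \<open>auto simp: ring_of_type_algebra_def\<close>)
  then have "primeideal M (as_ring R)"
    using A.is_cring t_maximal_prime[OF M] one_notin_t_maximal[OF M]
    by (intro primeidealI) (auto simp: ring_of_type_algebra_def)
  then show ?thesis using tM by (simp add: t_prime_def)
qed

lemma in_localization:
  assumes M: "t_maximal R M"
  shows "x \<in> localization R M \<longleftrightarrow> (\<exists>s. s \<in> R \<and> s \<notin> M \<and> s * x \<in> R)"
proof -
  have 0: "0 \<in> M" using t_ideal_zero[OF t_maximal_t_ideal[OF M]] .
  show ?thesis
  proof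
    assume "x \<in> localization R M"
    then obtain a s where a: "x = a / s" "a \<in> R" "s \<in> R - M" by (auto simp: localization_def)
    then have "s * x = a" using 0 by auto
    then show "\<exists>s. s \<in> R \<and> s \<notin> M \<and> s * x \<in> R" using a by auto
  next
    assume "\<exists>s. s \<in> R \<and> s \<notin> M \<and> s * x \<in> R"
    then obtain s where s: "s \<in> R" "s \<notin> M" "s * x \<in> R" by blast
    then have "x = (s * x) / s" using 0 by auto
    then show "x \<in> localization R M" using s unfolding localization_def by blast
  qed
qed

lemma subset_localization: "t_maximal R M \<Longrightarrow> R \<subseteq> localization R M"
  using one_notin_t_maximal by (auto simp: in_localization intro!: exI[of _ 1])

lemma localization_finite_denominator:
  assumes M: "t_maximal R M" and "finite S" "S \<subseteq> localization R M"
  shows "\<exists>d. d \<in> R \<and> d \<notin> M \<and> (\<forall>s\<in>S. d * s \<in> R)"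
  using assms(2,3)
proof (induction S)
  case empty
  show ?case using one_notin_t_maximal[OF M] by (auto intro!: exI[of _ 1])
next
  case (insert x S)
  then obtain d where d: "d \<in> R" "d \<notin> M" "\<forall>s\<in>S. d * s \<in> R" by auto
  obtain e where e: "e \<in> R" "e \<notin> M" "e * x \<in> R"
    using insert.prems by (auto simp: in_localization[OF M])
  have "d * e * s \<in> R" if "s \<in> S" for s
    using mult_in[OF e(1), of "d * s"] d that by (simp add: ac_simps)
  moreover have "d * e * x \<in> R" using mult_in[OF d(1) e(3)] by (simp add: ac_simps)
  moreover have "d * e \<notin> M" using t_maximal_prime[OF M d(1) e(1)] d e by blast
  ultimately show ?case using d e by (intro exI[of _ "d * e"]) (auto intro: mult_in)
qed

text \<open>
  Finitely many elements of \<open>R\<^sub>M\<close> have a common denominator outside \<open>M\<close>, and it is then a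
  denominator of every element of their \<open>v\<close>-closure.
\<close>

lemma t_hull_localization:
  assumes M: "t_maximal R M"
  shows "t_hull (localization R M) = localization R M"
proof
  show "t_hull (localization R M) \<subseteq> localization R M"
  proof
    fix x assume "x \<in> t_hull (localization R M)"
    then obtain S where S: "finite S" "S \<subseteq> localization R M" "x \<in> v_closure R S" by (rule t_hullE)
    obtain d where d: "d \<in> R" "d \<notin> M" "\<forall>s\<in>S. d * s \<in> R"
      using localization_finite_denominator[OF M S(1,2)] by blast
    have "x * d \<in> R" using d(3) by (intro v_closureD[OF S(3)]) auto
    then show "x \<in> localization R M" using d by (auto simp: in_localization[OF M] mult.commute)
  qed
qed (rule t_hull_superset)

lemma localization_submodule: "t_maximal R M \<Longrightarrow> submodule (localization R M)"
  using submodule_t_hull[of "localization R M"] by (simp add: t_hull_localization)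

lemma localization_mult:
  assumes M: "t_maximal R M" and "x \<in> localization R M" "y \<in> localization R M"
  shows "x * y \<in> localization R M"
proof -
  obtain d e where d: "d \<in> R" "d \<notin> M" "d * x \<in> R" and e: "e \<in> R" "e \<notin> M" "e * y \<in> R"
    using assms by (auto simp: in_localization)
  then have "(d * e) * (x * y) \<in> R" using mult_in[OF d(3) e(3)] by (simp add: ac_simps)
  moreover have "d * e \<notin> M" using t_maximal_prime[OF M d(1) e(1)] d e by blast
  ultimately show ?thesis using d e by (auto simp: in_localization[OF M] intro: mult_in)
qed

lemma inverse_in_localization_iff:
  assumes M: "t_maximal R M" and x: "x \<in> R" "x \<noteq> 0"
  shows "inverse x \<in> localization R M \<longleftrightarrow> x \<notin> M"
proof
  assume "x \<notin> M"
  then show "inverse x \<in> localization R M" using x by (auto simp: in_localization[OF M])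
next
  assume "inverse x \<in> localization R M"
  then obtain s where s: "s \<in> R" "s \<notin> M" "s * inverse x \<in> R" by (auto simp: in_localization[OF M])
  show "x \<notin> M"
  proof
    assume "x \<in> M"
    then have "(s * inverse x) * x \<in> M" by (rule t_ideal_scale[OF t_maximal_t_ideal[OF M] s(3)])
    then show False using s x by (simp add: mult.assoc)
  qed
qed

text \<open>
  The denominators of \<open>x\<close> form a \<open>t\<close>-ideal, proper if \<open>x \<notin> R\<close>, and \<open>x\<close> is not in the localization at
  any \<open>t\<close>-maximal ideal containing it. So \<open>R\<close> is the intersection of these localizations.
\<close>

lemma ex_localization_notin:
  assumes "x \<notin> R"
  shows "\<exists>M. t_maximal R M \<and> x \<notin> localization R M"
proof -
  let ?I = "inverse_ideal R {1, x}"
  obtain a b where ab: "a \<in> R" "b \<in> R" "b \<noteq> 0" "x = a / b" by (rule fractionE)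
  have "?I \<subseteq> R" by (auto simp: in_inverse_ideal)
  moreover have "b \<in> ?I" using ab by (auto simp: in_inverse_ideal)
  ultimately have "t_ideal R ?I" using ab by (intro t_ideal_subset_R_I[of _ b]) auto
  moreover have "1 \<notin> ?I" using assms by (auto simp: in_inverse_ideal)
  ultimately obtain M where M: "t_maximal R M" "?I \<subseteq> M" using \<open>?I \<subseteq> R\<close> ex_t_maximal by blast
  then have "x \<notin> localization R M" by (auto simp: in_localization in_inverse_ideal)
  then show ?thesis using M by blast
qed

section \<open>\<open>t\<close>-invertibility\<close>

definition t_invertible :: "'k set \<Rightarrow> bool"
  where "t_invertible I \<longleftrightarrow> 1 \<in> t_hull (I * inverse_ideal R I)"

lemma mult_inverse_ideal_subset: "I * inverse_ideal R I \<subseteq> R"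
  by (auto simp: set_times_def in_inverse_ideal) (metis mult.commute)

lemma t_hull_mult_inverse_ideal:
  assumes "t_invertible I"
  shows "t_hull (I * inverse_ideal R I) = R"
proof
  show "t_hull (I * inverse_ideal R I) \<subseteq> R" by (rule t_hull_subset_R[OF mult_inverse_ideal_subset])
  show "R \<subseteq> t_hull (I * inverse_ideal R I)"
    using scale_in_t_hull[of _ 1 "I * inverse_ideal R I"] assms by (auto simp: t_invertible_def)
qed

lemma t_invertible_imp_clifford:
  assumes "\<And>I. t_ideal R I \<Longrightarrow> t_invertible I"
  shows "clifford_t_regular R"
  unfolding clifford_t_regular_iff
proof (intro allI impI)
  fix I assume I: "t_ideal R I"
  have "t_hull (I * I * inverse_ideal R I) = t_hull (I * t_hull (I * inverse_ideal R I))"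
    by (simp add: mult.assoc)
  also have "\<dots> = I"
    using t_hull_mult_inverse_ideal[OF assms[OF I]] I
    by (simp add: mult.commute[of I R] R_mult_t_ideal t_ideal_t_hull)
  finally show "\<exists>J. t_ideal R J \<and> t_hull (I * I * J) = I" using t_ideal_inverse_ideal[OF I] by blast
qed

text \<open>
  For a nonzero \<open>b \<in> B\<close> all \<open>y\<^sup>n b\<close> stay in \<open>B\<close>, and \<open>B\<close> has a common denominator.
\<close>

lemma completely_integrally_closed_stable:
  assumes cic: "completely_integrally_closed R" and B: "t_ideal R B"
    and y: "\<And>b. b \<in> B \<Longrightarrow> y * b \<in> B"
  shows "y \<in> R"
proof -
  obtain b where b: "b \<in> B" "b \<noteq> 0" using B by (rule t_ideal_nonzeroE)
  obtain d where d: "d \<in> R" "d \<noteq> 0" "\<forall>x\<in>B. d * x \<in> R" using B by (rule t_ideal_boundedE)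
  have "y ^ n * b \<in> B" for n
    by (induction n) (use b y in \<open>auto simp: mult.assoc\<close>)
  then have "d * (y ^ n * b) \<in> R" for n using d(3) by blast
  then have "\<forall>n. (d * b) * y ^ n \<in> R" by (simp add: ac_simps)
  moreover have "d * b \<in> R" "d * b \<noteq> 0" using b d by auto
  ultimately show ?thesis using cic unfolding completely_integrally_closed_def by blast
qed

text \<open>
  From \<open>(I I J)\<^sub>t = I\<close> take \<open>B = (I J)\<^sub>t\<close>. It is \<open>t\<close>-idempotent, so its elements map \<open>B\<close> into itself and
  lie in \<open>R\<close> by the preceding lemma; and \<open>B = R\<close> means that \<open>J\<close> is a \<open>t\<close>-inverse of \<open>I\<close>.
\<close>

lemma clifford_decomposition:
  assumes cic: "completely_integrally_closed R" and cl: "clifford_t_regular R" and I: "t_ideal R I"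
  shows "t_invertible I \<or>
    (\<exists>B. t_ideal R B \<and> B \<subseteq> R \<and> 1 \<notin> B \<and> t_hull (B * B) = B \<and> t_hull (I * B) = I)"
proof -
  obtain J where J: "t_ideal R J" "t_hull (I * I * J) = I"
    using cl I unfolding clifford_t_regular_iff by blast
  define B where "B = t_hull (I * J)"
  have B: "t_ideal R B" using I J(1) by (simp add: B_def t_ideal_mult)
  have IB: "t_hull (I * B) = I" using J(2) by (simp add: B_def mult.assoc)
  have BB: "t_hull (B * B) = B"
  proof -
    have "t_hull (B * B) = t_hull ((I * J) * (I * J))" by (simp add: B_def)
    also have "\<dots> = t_hull (I * I * J * J)" by (simp only: ac_simps)
    also have "\<dots> = t_hull (t_hull (I * I * J) * J)" by simp
    also have "\<dots> = B" by (simp only: J(2) B_def)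
    finally show ?thesis .
  qed
  have "B \<subseteq> R"
  proof
    fix y assume "y \<in> B"
    then have "y * b \<in> B" if "b \<in> B" for b
      using that BB t_hull_superset[of "B * B"] by blast
    then show "y \<in> R" by (rule completely_integrally_closed_stable[OF cic B])
  qed
  moreover have "t_invertible I" if "1 \<in> B"
  proof -
    have "J * I \<subseteq> R"
      using \<open>B \<subseteq> R\<close> t_hull_superset[of "I * J"] unfolding B_def by (simp add: mult.commute[of J])
    then have "J \<subseteq> inverse_ideal R I"
      by (auto simp: in_inverse_ideal intro!: subsetD[of "J * I" R])
    then have "B \<subseteq> t_hull (I * inverse_ideal R I)"
      unfolding B_def by (intro t_hull_mono set_times_mono2) auto
    then show ?thesis using that by (auto simp: t_invertible_def)
  qed
  ultimately show ?thesis using B BB IB by blast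
qed

text \<open>
  An idempotent \<open>B \<noteq> R\<close> as above would lie in a \<open>t\<close>-maximal ideal \<open>M\<close>. If \<open>M\<close> had such an idempotent
  \<open>C\<close> as well, then \<open>M = (M C)\<^sub>t \<subseteq> C\<close>, so \<open>M = C\<close> would be \<open>t\<close>-idempotent. Hence \<open>M\<close> is
  \<open>t\<close>-invertible, and any \<open>y \<in> M\<inverse>\<close> outside \<open>R\<close> contradicts complete integral closure because
  \<open>y B \<subseteq> B\<close>.
\<close>

lemma clifford_imp_t_invertible:
  assumes cic: "completely_integrally_closed R" and cl: "clifford_t_regular R"
    and std: "strongly_t_discrete R" and I: "t_ideal R I"
  shows "t_invertible I"
proof (rule ccontr)
  assume "\<not> t_invertible I"
  then obtain B where B: "t_ideal R B" "B \<subseteq> R" "1 \<notin> B" "t_hull (B * B) = B"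
    using clifford_decomposition[OF cic cl I] by blast
  obtain M where M: "t_maximal R M" "B \<subseteq> M" using B ex_t_maximal by blast
  note tM = t_maximal_t_ideal[OF M(1)] and MR = t_maximal_subset[OF M(1)]
  have ss: "t_hull (M * M) \<noteq> M"
    using std t_maximal_t_prime[OF M(1)] t_closure_mult[OF tM tM]
    unfolding strongly_t_discrete_def by auto
  have "t_invertible M"
  proof (rule ccontr)
    assume "\<not> t_invertible M"
    then obtain C where C: "t_ideal R C" "C \<subseteq> R" "1 \<notin> C" "t_hull (C * C) = C" "t_hull (M * C) = M"
      using clifford_decomposition[OF cic cl tM] by blast
    have "M * C \<subseteq> C" using MR t_ideal_scale[OF C(1)] by (auto simp: set_times_def)
    then have "M \<subseteq> C" using t_hull_subset_t_ideal[OF C(1)] C(5) by blast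
    moreover have "C \<subset> R" using C(2,3) one_in by blast
    ultimately have "C = M" using M(1) C(1) unfolding t_maximal_def by blast
    then show False using C(4) ss by blast
  qed
  have "\<not> inverse_ideal R M \<subseteq> R"
  proof
    assume "inverse_ideal R M \<subseteq> R"
    then have "M * inverse_ideal R M \<subseteq> M"
      using t_ideal_scale_right[OF tM] by (auto simp: set_times_def)
    then show False
      using \<open>t_invertible M\<close> one_notin_t_maximal[OF M(1)] t_hull_subset_t_ideal[OF tM]
      unfolding t_invertible_def by blast
  qed
  then obtain y where y: "y \<in> inverse_ideal R M" "y \<notin> R" by blast
  have "{y} * B \<subseteq> B"
  proof -
    have "{y} * B \<subseteq> R" using y(1) M(2) by (auto simp: set_times_def in_inverse_ideal)
    then have "({y} * B) * B \<subseteq> R * B" by (intro set_times_mono2) auto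
    then have "{y} * (B * B) \<subseteq> B" by (simp add: R_mult_t_ideal[OF B(1)] mult.assoc)
    then have "t_hull ({y} * (B * B)) \<subseteq> B" by (rule t_hull_subset_t_ideal[OF B(1)])
    moreover have "{y} * B \<subseteq> t_hull ({y} * t_hull (B * B))"
      using t_hull_superset[of "{y} * B"] by (simp only: B(4))
    ultimately show ?thesis by simp
  qed
  then have "y * b \<in> B" if "b \<in> B" for b using that by blast
  then have "y \<in> R" by (rule completely_integrally_closed_stable[OF cic B(1)])
  with y show False by blast
qed

end

section \<open>Discrete valuation rings\<close>

lemma discrete_valuationD:
  assumes "discrete_valuation v"
  shows "x \<noteq> 0 \<Longrightarrow> y \<noteq> 0 \<Longrightarrow> v (x * y) = v x + v y"
    and "x \<noteq> 0 \<Longrightarrow> y \<noteq> 0 \<Longrightarrow> x + y \<noteq> 0 \<Longrightarrow> min (v x) (v y) \<le> v (x + y)"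
  using assms by (auto simp: discrete_valuation_def)

lemma discrete_valuation_one: "discrete_valuation v \<Longrightarrow> v (1 :: 'k::field) = 0"
  using discrete_valuationD(1)[of v 1 1] by simp

lemma discrete_valuation_divide:
  assumes "discrete_valuation v" "x \<noteq> 0" "y \<noteq> (0 :: 'k::field)"
  shows "v (x / y) = v x - v y"
  using discrete_valuationD(1)[OF assms(1), of "x / y" y] assms by simp

lemma discrete_valuation_power:
  assumes "discrete_valuation v" "x \<noteq> (0 :: 'k::field)"
  shows "v (x ^ n) = int n * v x"
  using assms
  by (induction n) (auto simp: discrete_valuation_one discrete_valuationD(1) algebra_simps)

lemma rank_one_dvrE:
  assumes "rank_one_dvr (V :: 'k::field set)"
  obtains v where "discrete_valuation v" "\<forall>x. x \<in> V \<longleftrightarrow> x = 0 \<or> 0 \<le> v x"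
proof -
  obtain v where "discrete_valuation v" "V = insert 0 {x. x \<noteq> 0 \<and> 0 \<le> v x}"
    using assms by (auto simp: rank_one_dvr_def)
  then show thesis by (intro that[of v]) auto
qed

lemma rank_one_dvr_mult:
  assumes "rank_one_dvr (V :: 'k::field set)" "x \<in> V" "y \<in> V"
  shows "x * y \<in> V"
proof -
  obtain v where v: "discrete_valuation v" "\<forall>x. x \<in> V \<longleftrightarrow> x = 0 \<or> 0 \<le> v x"
    using assms(1) by (rule rank_one_dvrE)
  then show ?thesis
    using assms(2,3) by (cases "x = 0 \<or> y = 0") (auto simp: discrete_valuationD(1))
qed

lemma rank_one_dvr_least_value:
  assumes V: "rank_one_dvr (V :: 'k::field set)" and A: "A \<subseteq> V" "\<not> A \<subseteq> {0}"
  obtains p where "p \<in> A" "p \<noteq> 0" "\<And>x. x \<in> A \<Longrightarrow> x / p \<in> V"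
proof -
  obtain v where v: "discrete_valuation v" "\<forall>x. x \<in> V \<longleftrightarrow> x = 0 \<or> 0 \<le> v x"
    using V by (rule rank_one_dvrE)
  obtain a where "a \<in> A \<and> a \<noteq> 0" using A(2) by blast
  then obtain p where p: "p \<in> A \<and> p \<noteq> 0"
    "\<And>x. x \<in> A \<and> x \<noteq> 0 \<Longrightarrow> nat (v p) \<le> nat (v x)"
    using ex_has_least_nat[of "\<lambda>x. x \<in> A \<and> x \<noteq> 0" a "\<lambda>x. nat (v x)"] by blast
  show thesis
  proof (rule that[of p])
    fix x assume x: "x \<in> A"
    show "x / p \<in> V"
    proof (cases "x = 0")
      case False
      then have "nat (v p) \<le> nat (v x)" "0 \<le> v p" "0 \<le> v x" using p x A(1) v(2) by auto
      then show ?thesis using False p v by (auto simp: discrete_valuation_divide)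
    qed (simp add: v(2))
  qed (use p in auto)
qed

lemma rank_one_dvr_completely_integrally_closed:
  assumes V: "rank_one_dvr (V :: 'k::field set)" and d: "d \<noteq> 0" "\<And>n. d * x ^ n \<in> V"
  shows "x \<in> V"
proof (rule ccontr)
  assume "x \<notin> V"
  obtain v where v: "discrete_valuation v" "\<forall>x. x \<in> V \<longleftrightarrow> x = 0 \<or> 0 \<le> v x"
    using V by (rule rank_one_dvrE)
  then have x: "x \<noteq> 0" "v x < 0" using \<open>x \<notin> V\<close> by auto
  have "0 \<le> v d + int n * v x" for n
  proof -
    have "0 \<le> v (d * x ^ n)" using d(2)[of n] d(1) x v(2) by auto
    then show ?thesis
      using discrete_valuationD(1)[OF v(1), of d "x ^ n"] d(1) x(1) v(1)
      by (simp add: discrete_valuation_power)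
  qed
  (* As v x is at most - 1, the exponent n = v d + 1 makes this value negative. *)
  from this[of "nat (v d + 1)"] this[of 0] have "0 \<le> v d + (v d + 1) * v x" "0 \<le> v d" by auto
  moreover have "(v d + 1) * v x \<le> (v d + 1) * (- 1)"
    using x(2) \<open>0 \<le> v d\<close> by (intro mult_left_mono) auto
  ultimately show False by simp
qed

text \<open>
  A criterion in terms of a uniformizer: if every non-unit of \<open>V\<close> is a multiple of \<open>\<pi>\<close> and no nonzero element
  is divisible by all powers of \<open>\<pi>\<close>, then each nonzero element of the field is a unit of \<open>V\<close> times a
  unique power of \<open>\<pi>\<close>, and the exponent is a discrete valuation.
\<close>

lemma rank_one_dvrI:
  fixes V :: "'k::field set"
  assumes zero: "0 \<in> V" and one: "1 \<in> V" and add: "\<And>x y. x \<in> V \<Longrightarrow> y \<in> V \<Longrightarrow> x + y \<in> V"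
    and mult: "\<And>x y. x \<in> V \<Longrightarrow> y \<in> V \<Longrightarrow> x * y \<in> V"
    and frac: "\<And>x. \<exists>a\<in>V. \<exists>b\<in>V. b \<noteq> 0 \<and> x = a / b"
    and \<pi>: "\<pi> \<in> V" "\<pi> \<noteq> 0" "inverse \<pi> \<notin> V"
    and nonunit: "\<And>x. x \<in> V \<Longrightarrow> inverse x \<notin> V \<Longrightarrow> x / \<pi> \<in> V"
    and separated: "\<And>x. x \<noteq> 0 \<Longrightarrow> \<exists>n. x / \<pi> ^ n \<notin> V"
  shows "rank_one_dvr V"
proof -
  define U where "U x \<longleftrightarrow> x \<noteq> 0 \<and> x \<in> V \<and> inverse x \<in> V" for x
  have U_one: "U 1" using one by (simp add: U_def)
  have U_mult: "U (x * y)" if "U x" "U y" for x y using that mult by (auto simp: U_def)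
  have U_divide: "U (x / y)" if "U x" "U y" for x y
    using that mult[of x "inverse y"] mult[of "inverse x" y]
    by (auto simp: U_def divide_inverse mult.commute)
  have pow: "\<pi> ^ n \<in> V" for n by (induction n) (auto simp: one \<pi> intro: mult)
  have not_U: "\<not> U (\<pi> powi i)" if i: "0 < i" for i
  proof
    assume U: "U (\<pi> powi i)"
    obtain m where m: "i = int (Suc m)"
      using zero_less_imp_eq_int[OF i] gr0_implies_Suc by blast
    have "\<pi> powi i = \<pi> ^ Suc m" by (simp only: m power_int_of_nat)
    then have "inverse (\<pi> ^ Suc m) * \<pi> ^ m \<in> V"
      using U pow by (intro mult) (simp_all only: U_def)
    then show False using \<pi> by (simp add: field_simps)
  qed
  have unique: "i = j" if "U (x / \<pi> powi i)" "U (x / \<pi> powi j)" for i j x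
  proof -
    have "\<not> i < j" if "U (x / \<pi> powi i)" "U (x / \<pi> powi j)" for i j
    proof
      assume "i < j"
      have "(x / \<pi> powi i) / (x / \<pi> powi j) = \<pi> powi (j - i)"
        using that \<pi> by (auto simp: U_def power_int_diff)
      then show False using U_divide[OF that] not_U[of "j - i"] \<open>i < j\<close> by auto
    qed
    then show ?thesis using that by (meson linorder_neqE)
  qed
  have exponent: "\<exists>n::nat. U (x / \<pi> ^ n)" if x: "x \<in> V" "x \<noteq> 0" for x
  proof -
    define n where "n = (LEAST n. x / \<pi> ^ n \<notin> V)"
    have n: "x / \<pi> ^ n \<notin> V" unfolding n_def using separated[OF x(2)] by (rule LeastI_ex)
    then have "n \<noteq> 0" using x by (cases n) auto
    then obtain k where k: "n = Suc k" using not0_implies_Suc by blast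
    have k': "x / \<pi> ^ k \<in> V" using not_less_Least[of k "\<lambda>n. x / \<pi> ^ n \<notin> V"] k n_def by auto
    have "(x / \<pi> ^ k) / \<pi> \<notin> V" using n k by (simp add: field_simps)
    then have "inverse (x / \<pi> ^ k) \<in> V" using nonunit[OF k'] by blast
    then have "U (x / \<pi> ^ k)" using k' x \<pi> by (simp add: U_def)
    then show ?thesis by blast
  qed
  have ex: "\<exists>i. U (x / \<pi> powi i)" if "x \<noteq> 0" for x
  proof -
    obtain a b where ab: "a \<in> V" "b \<in> V" "b \<noteq> 0" "x = a / b" using frac by blast
    then have "a \<noteq> 0" using that by auto
    then obtain m n where "U (a / \<pi> ^ m)" "U (b / \<pi> ^ n)" using exponent ab by metis
    then have "U ((a / \<pi> ^ m) / (b / \<pi> ^ n))" by (rule U_divide)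
    also have "(a / \<pi> ^ m) / (b / \<pi> ^ n) = x / \<pi> powi (int m - int n)"
      using \<pi> ab by (simp add: power_int_diff field_simps)
    finally show ?thesis by blast
  qed
  define v where "v x = (THE i. U (x / \<pi> powi i))" for x
  have v: "v x = i" if "U (x / \<pi> powi i)" for x i
    unfolding v_def using that unique by blast
  have Uv: "U (x / \<pi> powi v x)" if "x \<noteq> 0" for x
    using ex[OF that] v by metis
  have v_mult: "v (x * y) = v x + v y" if "x \<noteq> 0" "y \<noteq> 0" for x y
  proof (rule v)
    have "(x / \<pi> powi v x) * (y / \<pi> powi v y) = x * y / \<pi> powi (v x + v y)"
      using \<pi> by (simp add: power_int_add)
    then show "U (x * y / \<pi> powi (v x + v y))" using U_mult[OF Uv Uv, of x y] that by simp
  qed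
  have v_pow: "v (\<pi> powi i) = i" for i
    using \<pi> by (intro v) (simp add: U_one)
  have in_V: "x \<in> V \<longleftrightarrow> 0 \<le> v x" if x: "x \<noteq> 0" for x
  proof
    assume "x \<in> V"
    then obtain n where "U (x / \<pi> ^ n)" using exponent x by blast
    then have "v x = int n" by (intro v) simp
    then show "0 \<le> v x" by simp
  next
    assume "0 \<le> v x"
    then obtain n where n: "v x = int n" using nonneg_int_cases by blast
    have "x / \<pi> ^ n \<in> V" using Uv[OF x] by (simp add: n U_def)
    then have "(x / \<pi> ^ n) * \<pi> ^ n \<in> V" using pow by (rule mult)
    then show "x \<in> V" using \<pi> by simp
  qed
  have v_add: "v x \<le> v (x + y)" if "x \<noteq> 0" "y \<noteq> 0" "x + y \<noteq> 0" "v x \<le> v y" for x y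
  proof -
    define p where "p = \<pi> powi v x"
    have p: "p \<noteq> 0" "v p = v x" using \<pi> by (auto simp: p_def v_pow)
    have val: "v (z / p) = v z - v x" if "z \<noteq> 0" for z
      using v_mult[of "z / p" p] p that by simp
    have "x / p \<in> V" "y / p \<in> V" using that p val by (auto simp: in_V)
    then have "(x + y) / p \<in> V" using add by (simp add: add_divide_distrib)
    then show ?thesis using that p val by (simp add: in_V)
  qed
  have "discrete_valuation v"
    unfolding discrete_valuation_def
  proof (intro conjI allI impI)
    fix x y :: 'k assume xy: "x \<noteq> 0" "y \<noteq> 0" "x + y \<noteq> 0"
    show "min (v x) (v y) \<le> v (x + y)"
      using v_add[of x y] v_add[of y x] xy by (auto simp: min_def add.commute)
  next
    show "v ` (UNIV - {0}) = UNIV"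
    proof (intro subset_antisym subsetI)
      fix i show "i \<in> v ` (UNIV - {0})" using v_pow[of i] \<pi> by (intro image_eqI[of _ _ "\<pi> powi i"]) auto
    qed simp
  qed (rule v_mult)
  moreover have "V = insert 0 {x. x \<noteq> 0 \<and> 0 \<le> v x}" using in_V zero by auto
  ultimately show ?thesis unfolding rank_one_dvr_def by blast
qed

context domain_in_field
begin

section \<open>\<open>t\<close>-almost Dedekind domains\<close>

lemma t_almost_dedekind_imp_completely_integrally_closed:
  assumes "t_almost_dedekind R"
  shows "completely_integrally_closed R"
  unfolding completely_integrally_closed_def
proof (intro allI impI)
  fix x assume "\<exists>d\<in>R. d \<noteq> 0 \<and> (\<forall>n::nat. d * x ^ n \<in> R)"
  then obtain d where d: "d \<noteq> 0" "\<And>n. d * x ^ n \<in> R" by blast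
  show "x \<in> R"
  proof (rule ccontr)
    assume "x \<notin> R"
    then obtain M where M: "t_maximal R M" "x \<notin> localization R M"
      using ex_localization_notin by blast
    moreover have "rank_one_dvr (localization R M)"
      using assms M(1) by (simp add: t_almost_dedekind_def)
    ultimately show False
      using rank_one_dvr_completely_integrally_closed[of "localization R M" d x] d
        subset_localization[OF M(1)] by blast
  qed
qed

text \<open>
  If \<open>p\<close> has least value in \<open>P\<close> at a \<open>t\<close>-maximal \<open>M\<close> above \<open>P\<close>, then \<open>(P\<^sup>2)\<^sub>t\<close> lies in
  \<open>p\<^sup>2 R\<^sub>M\<close>, which does not contain \<open>p\<close>.
\<close>

lemma t_almost_dedekind_imp_strongly_t_discrete:
  assumes "t_almost_dedekind R"
  shows "strongly_t_discrete R"
  unfolding strongly_t_discrete_def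
proof (intro allI impI)
  fix P assume "t_prime R P"
  then have pr: "primeideal P (as_ring R)" and tP: "t_ideal R P" by (auto simp: t_prime_def)
  interpret primeideal P "as_ring R" by (rule pr)
  have PR: "P \<subseteq> R" using a_subset by simp
  have "1 \<notin> P" using t_ideal_eq_R[OF tP PR] I_notcarr by auto
  then obtain M where M: "t_maximal R M" "P \<subseteq> M" using tP PR ex_t_maximal by blast
  let ?V = "localization R M"
  have V: "rank_one_dvr ?V" using assms M(1) by (simp add: t_almost_dedekind_def)
  have "P \<subseteq> ?V" "\<not> P \<subseteq> {0}" using PR subset_localization[OF M(1)] tP by (auto elim: t_ideal_nonzeroE)
  then obtain p where p: "p \<in> P" "p \<noteq> 0" "\<forall>x\<in>P. x / p \<in> ?V"
    using rank_one_dvr_least_value[OF V] by metis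
  have "P * P \<subseteq> {p * p} * ?V"
  proof
    fix w assume "w \<in> P * P"
    then obtain x y where w: "w = x * y" "x \<in> P" "y \<in> P" by (auto simp: set_times_def)
    have "(x / p) * (y / p) \<in> ?V"
      using w(2,3) p(3) by (intro localization_mult[OF M(1)]) auto
    then show "w \<in> {p * p} * ?V" using p(2) by (simp add: w(1) in_singleton_mult)
  qed
  then have "t_hull (P * P) \<subseteq> {p * p} * ?V"
    using t_hull_mono[of "P * P" "{p * p} * ?V"] p(2)
    by (simp add: t_hull_singleton_mult t_hull_localization[OF M(1)])
  moreover have "p \<notin> {p * p} * ?V"
  proof
    assume "p \<in> {p * p} * ?V"
    then have "p / (p * p) \<in> ?V" using p(2) by (simp add: in_singleton_mult)
    also have "p / (p * p) = inverse p" using p(2) by (simp add: field_simps)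
    finally have "inverse p \<in> ?V" .
    then show False using inverse_in_localization_iff[OF M(1), of p] p PR M(2) by auto
  qed
  moreover have "t_hull (P * P) \<subseteq> P"
    using PR t_ideal_scale[OF tP] by (intro t_hull_subset_t_ideal[OF tP]) (auto simp: set_times_def)
  ultimately show "t_closure R (P \<cdot>\<^bsub>field_ring\<^esub> P) \<subset> P"
    using p(1) by (auto simp: t_closure_mult[OF tP tP])
qed

section \<open>Domains in which every \<open>t\<close>-ideal is \<open>t\<close>-invertible\<close>

text \<open>If \<open>y I \<subseteq> I\<close>, then \<open>y \<in> y (I I\<inverse>)\<^sub>t \<subseteq> (I I\<inverse>)\<^sub>t = R\<close>.\<close>

lemma t_invertible_stable:
  assumes "t_invertible I" and y: "\<And>x. x \<in> I \<Longrightarrow> y * x \<in> I"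
  shows "y \<in> R"
proof -
  have "{y} * (I * inverse_ideal R I) \<subseteq> I * inverse_ideal R I"
  proof -
    have "{y} * I \<subseteq> I" using y by (auto simp: set_times_def)
    then have "({y} * I) * inverse_ideal R I \<subseteq> I * inverse_ideal R I"
      by (intro set_times_mono2) auto
    then show ?thesis by (simp only: mult.assoc)
  qed
  then have "t_hull ({y} * (I * inverse_ideal R I)) \<subseteq> R"
    using mult_inverse_ideal_subset by (intro t_hull_subset_R) blast
  moreover have "y * 1 \<in> t_hull ({y} * (I * inverse_ideal R I))"
    using assms(1) t_hull_mult_subset[of "{y}" "I * inverse_ideal R I"] t_hull_superset[of "{y}"]
    unfolding t_invertible_def by blast
  ultimately show ?thesis by auto
qed

lemma t_invertible_t_maximalE:
  assumes M: "t_maximal R M" and inv: "t_invertible M"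
  obtains m n where "m \<in> M" "m \<noteq> 0" "n \<in> inverse_ideal R M" "m * n \<in> R" "m * n \<notin> M"
proof -
  have "\<not> M * inverse_ideal R M \<subseteq> M"
    using inv one_notin_t_maximal[OF M] t_hull_subset_t_ideal[OF t_maximal_t_ideal[OF M]]
    unfolding t_invertible_def by blast
  then obtain m n where mn: "m \<in> M" "n \<in> inverse_ideal R M" "m * n \<notin> M"
    by (auto simp: set_times_def)
  moreover have "m \<noteq> 0" using mn t_ideal_zero[OF t_maximal_t_ideal[OF M]] by auto
  moreover have "m * n \<in> R" using mn mult_inverse_ideal_subset[of M] by blast
  ultimately show thesis using that by blast
qed

text \<open>
  Choose \<open>m \<in> M\<close> and \<open>n \<in> M\<inverse>\<close> with \<open>m n \<notin> M\<close>. Then \<open>m\<close> generates the maximal ideal of \<open>R\<^sub>M\<close>, since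
  \<open>x = m (n x) / (m n)\<close> for \<open>x \<in> M\<close>. The elements of \<open>R\<close> divisible by all powers of \<open>m\<close> in \<open>R\<^sub>M\<close> form
  a set \<open>I\<close> with \<open>n I \<subseteq> I\<close>, because multiplication by \<open>n\<close> amounts to division by \<open>m\<close> up to a unit of
  \<open>R\<^sub>M\<close>. If \<open>I\<close> contained a nonzero element, it would be a \<open>t\<close>-ideal, so \<open>n\<close> would lie in \<open>R\<close> and
  \<open>m n\<close> in \<open>M\<close>.
\<close>

lemma t_invertible_imp_t_almost_dedekind:
  assumes inv: "\<And>I. t_ideal R I \<Longrightarrow> t_invertible I"
  shows "t_almost_dedekind R"
  unfolding t_almost_dedekind_def
proof (intro allI impI)
  fix M assume M: "t_maximal R M"
  note tM = t_maximal_t_ideal[OF M] and MR = t_maximal_subset[OF M]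
  let ?V = "localization R M"
  note sub = localization_submodule[OF M, unfolded submodule_def]
  have RV: "R \<subseteq> ?V" by (rule subset_localization[OF M])
  obtain m n where mn: "m \<in> M" "m \<noteq> 0" "n \<in> inverse_ideal R M" "m * n \<in> R" "m * n \<notin> M"
    using t_invertible_t_maximalE[OF M inv[OF tM]] by metis
  have n0: "n \<noteq> 0" using mn t_ideal_zero[OF tM] by auto
  have uV: "inverse (m * n) \<in> ?V"
    using inverse_in_localization_iff[OF M mn(4)] mn n0 by simp
  have M_div: "x / m \<in> ?V" if "x \<in> M" for x
  proof -
    have "n * x \<in> R" using mn(3) that by (simp add: in_inverse_ideal)
    then have "(n * x) * inverse (m * n) \<in> ?V" using RV by (intro localization_mult[OF M _ uV]) blast
    then show ?thesis using n0 mn(2) by (simp add: field_simps)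
  qed
  show "rank_one_dvr ?V"
  proof (rule rank_one_dvrI)
    show "0 \<in> ?V" using sub by blast
    show "1 \<in> ?V" "m \<in> ?V" using RV MR mn(1) by auto
    show "x + y \<in> ?V" if "x \<in> ?V" "y \<in> ?V" for x y using sub that by blast
    show "x * y \<in> ?V" if "x \<in> ?V" "y \<in> ?V" for x y by (rule localization_mult[OF M that])
    show "\<exists>a\<in>?V. \<exists>b\<in>?V. b \<noteq> 0 \<and> x = a / b" for x
    proof -
      obtain a b where "a \<in> R" "b \<in> R" "b \<noteq> 0" "x = a / b" by (rule fractionE)
      then show ?thesis using RV by blast
    qed
    show "m \<noteq> 0" by (rule mn)
    show "inverse m \<notin> ?V" using inverse_in_localization_iff[OF M, of m] mn MR by auto
    show "x / m \<in> ?V" if x: "x \<in> ?V" "inverse x \<notin> ?V" for x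
    proof -
      obtain s where s: "s \<in> R" "s \<notin> M" "s * x \<in> R" using x(1) by (auto simp: in_localization[OF M])
      have s0: "s \<noteq> 0" using s t_ideal_zero[OF tM] by auto
      have sV: "inverse s \<in> ?V" using inverse_in_localization_iff[OF M s(1) s0] s by simp
      have "s * x \<in> M"
      proof (rule ccontr)
        assume "s * x \<notin> M"
        then have "s * x \<noteq> 0" using t_ideal_zero[OF tM] by auto
        then have "inverse (s * x) \<in> ?V"
          using inverse_in_localization_iff[OF M s(3)] \<open>s * x \<notin> M\<close> by simp
        then have "s * inverse (s * x) \<in> ?V" using RV s(1) by (intro localization_mult[OF M]) auto
        then show False using x(2) s0 by (simp flip: mult.assoc)
      qed
      then have "inverse s * (s * x / m) \<in> ?V" by (intro localization_mult[OF M] sV M_div)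
      then show ?thesis using s0 by (simp flip: mult.assoc)
    qed
    show "\<exists>k. x / m ^ k \<notin> ?V" if x: "x \<noteq> 0" for x
    proof (rule ccontr)
      assume "\<not> (\<exists>k. x / m ^ k \<notin> ?V)"
      then have xV: "x / m ^ k \<in> ?V" for k by blast
      define I where "I = {y \<in> R. \<forall>k. y / m ^ k \<in> ?V}"
      obtain a b where ab: "a \<in> R" "b \<in> R" "b \<noteq> 0" "x = a / b" by (rule fractionE)
      have "a / m ^ k \<in> ?V" for k
      proof -
        have "b * (x / m ^ k) \<in> ?V" using sub ab(2) xV by blast
        then show ?thesis using ab by simp
      qed
      then have aI: "a \<in> I" "a \<noteq> 0" using ab x by (auto simp: I_def)
      have "t_hull I \<subseteq> I"
      proof
        fix y assume y: "y \<in> t_hull I"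
        have "I \<subseteq> {m ^ k} * ?V" for k using mn(2) by (auto simp: in_singleton_mult I_def)
        then have "t_hull I \<subseteq> {m ^ k} * ?V" for k
          using t_hull_mono[of I "{m ^ k} * ?V"] mn(2)
          by (simp add: t_hull_singleton_mult t_hull_localization[OF M])
        then have "y \<in> {m ^ k} * ?V" for k using y by blast
        then have "y / m ^ k \<in> ?V" for k using mn(2) by (simp add: in_singleton_mult)
        moreover have "y \<in> R" using y t_hull_subset_R[of I] by (auto simp: I_def)
        ultimately show "y \<in> I" by (simp add: I_def)
      qed
      then have "t_ideal R I"
        using aI t_hull_superset[of I] by (intro t_ideal_subset_R_I[of I a]) (auto simp: I_def)
      moreover have "n * y \<in> I" if y: "y \<in> I" for y
      proof -
        have "y \<in> M"
        proof (rule ccontr)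
          assume "y \<notin> M"
          then have "y \<noteq> 0" using t_ideal_zero[OF tM] by auto
          have "y \<in> R" "y / m ^ 1 \<in> ?V" using y unfolding I_def by blast+
          then have "inverse y * (y / m ^ 1) \<in> ?V"
            using inverse_in_localization_iff[OF M \<open>y \<in> R\<close> \<open>y \<noteq> 0\<close>] \<open>y \<notin> M\<close>
            by (intro localization_mult[OF M]) auto
          then have "inverse m \<in> ?V" using \<open>y \<noteq> 0\<close> by (simp add: field_simps)
          then show False using inverse_in_localization_iff[OF M, of m] mn MR by auto
        qed
        then have "n * y \<in> R" using mn(3) by (simp add: in_inverse_ideal)
        moreover have "n * y / m ^ k \<in> ?V" for k
        proof -
          have "y / m ^ Suc k \<in> ?V" using y unfolding I_def by blast
          then have "(m * n) * (y / m ^ Suc k) \<in> ?V" using sub mn(4) by blast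
          then show ?thesis using mn(2) by (simp add: field_simps)
        qed
        ultimately show ?thesis by (simp add: I_def)
      qed
      ultimately have "n \<in> R" using inv t_invertible_stable by blast
      then have "n * m \<in> M" using t_ideal_scale[OF tM] mn(1) by blast
      then show False using mn(5) by (simp add: mult.commute)
    qed
  qed
qed

text \<open>
  Only finitely many products \<open>s j\<close> with \<open>s \<in> I\<close> and \<open>j \<in> I\<inverse>\<close> are needed to see that
  \<open>1 \<in> (I I\<inverse>)\<^sub>t\<close>. For \<open>x \<in> I\<close> all \<open>x j\<close> are in \<open>R\<close>, so multiplying by \<open>x\<close> shows that the factors \<open>s\<close>
  already generate \<open>I\<close>.
\<close>

lemma t_invertible_finite_type:
  assumes I: "t_ideal R I" and inv: "t_invertible I"
  obtains S where "finite S" "S \<subseteq> I" "I = t_hull S"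
proof -
  obtain T where T: "finite T" "T \<subseteq> I * inverse_ideal R I" "1 \<in> v_closure R T"
    using inv unfolding t_invertible_def by (rule t_hullE)
  have "\<forall>t\<in>T. \<exists>s. s \<in> I \<and> (\<exists>j\<in>inverse_ideal R I. t = s * j)"
    using T(2) unfolding set_times_def by blast
  then obtain f where f: "\<forall>t\<in>T. f t \<in> I \<and> (\<exists>j\<in>inverse_ideal R I. t = f t * j)" by metis
  define S where "S = f ` T"
  have S: "finite S" "S \<subseteq> I" using T f by (auto simp: S_def)
  have "T \<subseteq> S * inverse_ideal R I" using f unfolding S_def set_times_def by blast
  moreover have "1 \<in> t_hull T" using T by (auto simp: t_hull_def)
  ultimately have one: "1 \<in> t_hull (S * inverse_ideal R I)" using t_hull_mono by blast
  have "I \<subseteq> t_hull S"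
  proof
    fix x assume x: "x \<in> I"
    have "x * 1 \<in> t_hull ({x} * (S * inverse_ideal R I))"
      using one t_hull_mult_subset[of "{x}"] t_hull_superset[of "{x}"] by blast
    moreover have "{x} * (S * inverse_ideal R I) \<subseteq> t_hull S"
    proof -
      have "{x} * inverse_ideal R I \<subseteq> R"
        using x mult_inverse_ideal_subset[of I] by (auto simp: set_times_def)
      then have "({x} * inverse_ideal R I) * S \<subseteq> R * t_hull S"
        using t_hull_superset by (intro set_times_mono2)
      also have "\<dots> \<subseteq> t_hull S" using scale_in_t_hull by (auto simp: set_times_def)
      finally show ?thesis by (simp only: ac_simps)
    qed
    ultimately show "x \<in> t_hull S" using t_hull_least by auto
  qed
  then show thesis using S t_hull_subset_t_ideal[OF I S(2)] by (intro that[of S]) auto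
qed

text \<open>
  Let \<open>I\<close> consist of the elements of \<open>R\<close> that \<open>x\<close> divides in \<open>R\<^sub>M\<close> for all but finitely many of the
  \<open>t\<close>-maximal ideals \<open>M\<close> containing \<open>x\<close>. It is a \<open>t\<close>-ideal, so it is the \<open>t\<close>-closure of a finite set and
  finitely many exceptional \<open>M\<close> suffice for all of \<open>I\<close>. But each \<open>M\<close> containing \<open>x\<close> is exceptional for
  some element of \<open>I\<close>, namely for \<open>x n\<close> where \<open>n \<in> M\<inverse>\<close> is not in \<open>R\<^sub>M\<close>: such an \<open>n\<close> lies in the
  localizations at all other \<open>t\<close>-maximal ideals.
\<close>

lemma t_invertible_imp_finite_character:
  assumes inv: "\<And>I. t_ideal R I \<Longrightarrow> t_invertible I" and x: "x \<in> R" "x \<noteq> 0"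
  shows "finite {M. t_maximal R M \<and> x \<in> M}"
proof -
  let ?X = "{M. t_maximal R M \<and> x \<in> M}"
  define E where "E y = {M \<in> ?X. y / x \<notin> localization R M}" for y
  define I where "I = {y \<in> R. finite (E y)}"
  have E_hull: "E y \<subseteq> (\<Union>s\<in>S. E s)" if "y \<in> v_closure R S" "finite S" for y S
  proof
    fix M assume "M \<in> E y"
    then have M: "t_maximal R M" "x \<in> M" "y / x \<notin> localization R M" by (auto simp: E_def)
    show "M \<in> (\<Union>s\<in>S. E s)"
    proof (rule ccontr)
      assume "M \<notin> (\<Union>s\<in>S. E s)"
      then have S: "\<forall>s\<in>S. s / x \<in> localization R M" using M by (auto simp: E_def)
      then have "S \<subseteq> {x} * localization R M" using x(2) by (auto simp: in_singleton_mult)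
      moreover have "y \<in> t_hull S" using that by (auto simp: t_hull_def)
      ultimately have "y \<in> {x} * localization R M"
        using t_hull_mono[of S "{x} * localization R M"] x(2)
        by (auto simp: t_hull_singleton_mult t_hull_localization[OF M(1)])
      then show False using M(3) x(2) by (simp add: in_singleton_mult)
    qed
  qed
  have "E x = {}" using x(2) subsetD[OF subset_localization one_in] by (auto simp: E_def)
  then have xI: "x \<in> I" using x(1) by (simp add: I_def)
  have "t_hull I \<subseteq> I"
  proof
    fix y assume y: "y \<in> t_hull I"
    obtain S where S: "finite S" "S \<subseteq> I" "y \<in> v_closure R S" using y by (rule t_hullE)
    have "finite (\<Union>s\<in>S. E s)" using S by (auto simp: I_def)
    then have "finite (E y)" using E_hull[OF S(3,1)] by (rule rev_finite_subset)
    moreover have "y \<in> R" using y t_hull_subset_R[of I] by (auto simp: I_def)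
    ultimately show "y \<in> I" by (simp add: I_def)
  qed
  then have tI: "t_ideal R I"
    using xI x t_hull_superset[of I] by (intro t_ideal_subset_R_I[of I x]) (auto simp: I_def)
  obtain S where S: "finite S" "S \<subseteq> I" "I = t_hull S"
    using t_invertible_finite_type[OF tI inv[OF tI]] by metis
  have "?X \<subseteq> (\<Union>s\<in>S. E s)"
  proof
    fix M assume "M \<in> ?X"
    then have M: "t_maximal R M" "x \<in> M" by auto
    note tM = t_maximal_t_ideal[OF M(1)] and MR = t_maximal_subset[OF M(1)]
    obtain m n where mn: "m \<in> M" "m \<noteq> 0" "n \<in> inverse_ideal R M" "m * n \<in> R" "m * n \<notin> M"
      using t_invertible_t_maximalE[OF M(1) inv[OF tM]] by metis
    have nM: "n \<notin> localization R M"
    proof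
      assume "n \<in> localization R M"
      then obtain s where s: "s \<in> R" "s \<notin> M" "s * n \<in> R" by (auto simp: in_localization[OF M(1)])
      then have "(s * n) * m \<in> M" using t_ideal_scale[OF tM] mn(1) by blast
      then have "s * (m * n) \<in> M" by (simp add: ac_simps)
      then show False using t_maximal_prime[OF M(1) s(1) mn(4)] s mn by blast
    qed
    have nN: "n \<in> localization R N" if N: "t_maximal R N" "N \<noteq> M" for N
    proof -
      have "\<not> M \<subseteq> N" using M(1) N unfolding t_maximal_def by blast
      then obtain a where a: "a \<in> M" "a \<notin> N" by blast
      then have "a * n \<in> R" using mn(3) by (simp add: in_inverse_ideal mult.commute)
      then show ?thesis using a MR by (auto simp: in_localization[OF N(1)])
    qed
    have "E (x * n) \<subseteq> {M}" using nN x(2) by (auto simp: E_def)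
    then have "finite (E (x * n))" by (rule finite_subset) simp
    moreover have "x * n \<in> R" using mn(3) M(2) by (simp add: in_inverse_ideal mult.commute[of x])
    ultimately have "x * n \<in> I" by (simp add: I_def)
    then have "x * n \<in> t_hull S" using S(3) by blast
    then obtain T where T: "finite T" "T \<subseteq> S" "x * n \<in> v_closure R T" by (rule t_hullE)
    have "M \<in> E (x * n)" using M nM x(2) by (simp add: E_def)
    then show "M \<in> (\<Union>s\<in>S. E s)" using E_hull[OF T(3,1)] T(2) by blast
  qed
  moreover have "finite (\<Union>s\<in>S. E s)" using S by (auto simp: I_def)
  ultimately show ?thesis by (rule finite_subset)
qed

lemma t_invertible_imp_krull:
  assumes inv: "\<And>I. t_ideal R I \<Longrightarrow> t_invertible I"
  shows "krull_domain R"
proof -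
  let ?F = "localization R ` {M. t_maximal R M}"
  have "\<forall>V\<in>?F. rank_one_dvr V"
    using t_invertible_imp_t_almost_dedekind[OF inv] by (auto simp: t_almost_dedekind_def)
  moreover have "R = \<Inter>?F"
  proof
    show "R \<subseteq> \<Inter>?F" using subset_localization by blast
    show "\<Inter>?F \<subseteq> R" using ex_localization_notin by blast
  qed
  moreover have "finite {V \<in> ?F. inverse x \<notin> V}" if x: "x \<in> R" "x \<noteq> 0" for x
  proof (rule finite_subset)
    show "{V \<in> ?F. inverse x \<notin> V} \<subseteq> localization R ` {M. t_maximal R M \<and> x \<in> M}"
    proof
      fix V assume "V \<in> {V \<in> ?F. inverse x \<notin> V}"
      then obtain M where M: "t_maximal R M" "V = localization R M" "inverse x \<notin> V" by blast
      then have "x \<in> M" using inverse_in_localization_iff[OF M(1) x] by simp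
      then show "V \<in> localization R ` {M. t_maximal R M \<and> x \<in> M}" using M by blast
    qed
    show "finite (localization R ` {M. t_maximal R M \<and> x \<in> M})"
      by (intro finite_imageI t_invertible_imp_finite_character[OF inv x])
  qed
  ultimately show ?thesis unfolding krull_domain_def by (intro exI[of _ ?F]) simp
qed

text \<open>
  For \<open>H = I I\<inverse>\<close>, complete integral closure gives \<open>H\<inverse> = (I\<inverse> : I\<inverse>) = R\<close>. A finite subset of \<open>H\<close>
  already has this inverse: it suffices to take some \<open>a \<noteq> 0\<close> in \<open>H\<close>, and an element of least value for
  each of the finitely many valuation rings in which \<open>a\<close> is not a unit.
\<close>

lemma krull_imp_t_invertible:
  assumes "krull_domain R" and I: "t_ideal R I"
  shows "t_invertible I"
proof -
  obtain F where F: "\<forall>V\<in>F. rank_one_dvr V" "R = \<Inter>F"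
    "\<forall>x\<in>R. x \<noteq> 0 \<longrightarrow> finite {V \<in> F. inverse x \<notin> V}"
    using assms(1) unfolding krull_domain_def by blast
  have cic: "completely_integrally_closed R"
    unfolding completely_integrally_closed_def
  proof (intro allI impI)
    fix x assume "\<exists>d\<in>R. d \<noteq> 0 \<and> (\<forall>n::nat. d * x ^ n \<in> R)"
    then obtain d where d: "d \<noteq> 0" "\<And>n. d * x ^ n \<in> R" by blast
    have "x \<in> V" if V: "V \<in> F" for V
      by (rule rank_one_dvr_completely_integrally_closed[of V d]) (use V F(1,2) d in auto)
    then show "x \<in> R" unfolding F(2) by blast
  qed
  define H where "H = I * inverse_ideal R I"
  have HR: "H \<subseteq> R" unfolding H_def by (rule mult_inverse_ideal_subset)
  have H_inv: "z \<in> R" if z: "\<forall>h\<in>H. z * h \<in> R" for z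
  proof (rule completely_integrally_closed_stable[OF cic t_ideal_inverse_ideal[OF I]])
    fix j assume "j \<in> inverse_ideal R I"
    then have "z * (i * j) \<in> R" if "i \<in> I" for i using that z unfolding H_def by blast
    then show "z * j \<in> inverse_ideal R I" by (simp add: in_inverse_ideal ac_simps)
  qed
  obtain i where i: "i \<in> I" "i \<noteq> 0" using I by (rule t_ideal_nonzeroE)
  obtain j where j: "j \<in> inverse_ideal R I" "j \<noteq> 0"
    using t_ideal_inverse_ideal[OF I] by (rule t_ideal_nonzeroE)
  define a where "a = i * j"
  have a: "a \<in> H" "a \<noteq> 0" using i j by (auto simp: a_def H_def)
  define G where "G = {V \<in> F. inverse a \<notin> V}"
  have fin: "finite G" using F(3) a HR unfolding G_def by blast
  have "\<forall>V\<in>G. \<exists>p. p \<in> H \<and> p \<noteq> 0 \<and> (\<forall>x\<in>H. x / p \<in> V)"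
  proof
    fix V assume "V \<in> G"
    then have "rank_one_dvr V" "H \<subseteq> V" "\<not> H \<subseteq> {0}" using F HR a by (auto simp: G_def)
    then show "\<exists>p. p \<in> H \<and> p \<noteq> 0 \<and> (\<forall>x\<in>H. x / p \<in> V)"
      using rank_one_dvr_least_value[of V H] by metis
  qed
  then obtain p where p: "\<forall>V\<in>G. p V \<in> H \<and> p V \<noteq> 0 \<and> (\<forall>x\<in>H. x / p V \<in> V)" by metis
  have "1 \<in> t_hull H"
  proof (rule t_hullI)
    show "finite (insert a (p ` G))" using fin by simp
    show "insert a (p ` G) \<subseteq> H" using a p by auto
    fix z assume z: "\<And>s. s \<in> insert a (p ` G) \<Longrightarrow> z * s \<in> R"
    have "z * h \<in> V" if h: "h \<in> H" and V: "V \<in> F" for h V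
    proof -
      have dvr: "rank_one_dvr V" using F V by blast
      obtain s where s: "s \<in> insert a (p ` G)" "s \<noteq> 0" "h / s \<in> V"
      proof (cases "V \<in> G")
        case True
        then show ?thesis using p h that by blast
      next
        case False
        then have "inverse a \<in> V" "h \<in> V" using V h HR F(2) by (auto simp: G_def)
        then have "h / a \<in> V"
          using rank_one_dvr_mult[OF dvr, of h "inverse a"] by (simp add: divide_inverse)
        then show ?thesis using a that by blast
      qed
      have "z * s \<in> V" using z[OF s(1)] F(2) V by blast
      then have "(z * s) * (h / s) \<in> V" using s(3) by (rule rank_one_dvr_mult[OF dvr])
      then show ?thesis using s(2) by simp
    qed
    then have "\<forall>h\<in>H. z * h \<in> R" unfolding F(2) by blast
    then show "1 * z \<in> R" using H_inv by simp
  qed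
  then show ?thesis by (simp add: t_invertible_def H_def)
qed

section \<open>Unique factorization\<close>

abbreviation nonzero_monoid :: "'k monoid"
  where "nonzero_monoid \<equiv> mult_of (as_ring R)"

lemma nonzero_monoid_simps:
  "carrier nonzero_monoid = R - {0}" "x \<otimes>\<^bsub>nonzero_monoid\<^esub> y = x * y" "\<one>\<^bsub>nonzero_monoid\<^esub> = 1"
  by (auto simp: ring_of_type_algebra_def)

lemma comm_monoid_cancel_nonzero: "comm_monoid_cancel nonzero_monoid"
  by unfold_locales (auto simp: ring_of_type_algebra_def intro: mult_in)

lemma divides_iff:
  assumes "a \<in> R" "a \<noteq> 0" "b \<noteq> 0"
  shows "a divides\<^bsub>nonzero_monoid\<^esub> b \<longleftrightarrow> b / a \<in> R"
  unfolding factor_def nonzero_monoid_simps using assms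
  by (auto intro!: bexI[of _ "b / a"])

lemma ufd_iff_factorial: "ufd R \<longleftrightarrow> factorial_monoid nonzero_monoid"
  using domain_as_ring by (simp add: ufd_def factorial_domain_def)

text \<open>
  If a fraction \<open>p / q\<close> multiplies \<open>a\<close> and \<open>b\<close> into \<open>R\<close>, then \<open>q\<close> divides \<open>p a\<close> and \<open>p b\<close>, hence \<open>p\<close>
  times the greatest common divisor of \<open>a\<close> and \<open>b\<close>.
\<close>

lemma gcd_in_t_hull:
  assumes "gcd_condition_monoid nonzero_monoid" and a: "a \<in> R" "a \<noteq> 0" and b: "b \<in> R" "b \<noteq> 0"
  shows "somegcd nonzero_monoid a b \<in> t_hull {a, b}"
proof (rule t_hullI[of "{a, b}"])
  interpret gcd_condition_monoid nonzero_monoid by (rule assms(1))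
  let ?g = "somegcd nonzero_monoid a b"
  have carr: "a \<in> carrier nonzero_monoid" "b \<in> carrier nonzero_monoid"
    using a b by (simp_all only: nonzero_monoid_simps) auto
  have g: "?g \<in> R" "?g \<noteq> 0" using gcd_closed[OF carr] by (simp_all only: nonzero_monoid_simps) auto
  fix z assume z: "\<And>s. s \<in> {a, b} \<Longrightarrow> z * s \<in> R"
  show "?g * z \<in> R"
  proof (cases "z = 0")
    case False
    obtain p q where pq: "p \<in> R" "q \<in> R" "q \<noteq> 0" "z = p / q" by (rule fractionE)
    then have p0: "p \<noteq> 0" using False by auto
    have pqc: "p \<in> carrier nonzero_monoid" "q \<in> carrier nonzero_monoid"
      using pq p0 by (simp_all only: nonzero_monoid_simps) auto
    have "q divides\<^bsub>nonzero_monoid\<^esub> p * a" "q divides\<^bsub>nonzero_monoid\<^esub> p * b"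
      using z[of a] z[of b] pq p0 a b by (auto simp: divides_iff)
    then have "q divides\<^bsub>nonzero_monoid\<^esub> somegcd nonzero_monoid (p * a) (p * b)"
      using gcd_divides[of q "p * a" "p * b"] pqc carr m_closed[of p] by (simp only: nonzero_monoid_simps)
    moreover have "somegcd nonzero_monoid (p * a) (p * b) divides\<^bsub>nonzero_monoid\<^esub> p * ?g"
      using gcd_mult[OF carr pqc(1)] unfolding associated_def by (simp only: nonzero_monoid_simps)
    ultimately have "q divides\<^bsub>nonzero_monoid\<^esub> p * ?g" using pqc(2) by (rule divides_trans)
    then show ?thesis using pq p0 g by (simp add: divides_iff mult.commute)
  qed simp
qed auto

text \<open>
  In a factorial domain an element of an integral \<open>t\<close>-ideal that has no proper divisor in it divides
  every other element, since the ideal contains greatest common divisors.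
\<close>

lemma ufd_imp_principal:
  assumes "ufd R" and I: "t_ideal R I"
  shows "\<exists>c. c \<noteq> 0 \<and> I = {c} * R"
proof -
  interpret factorial_monoid nonzero_monoid using assms by (simp add: ufd_iff_factorial)
  obtain d where d: "d \<in> R" "d \<noteq> 0" "\<forall>x\<in>I. d * x \<in> R" using I by (rule t_ideal_boundedE)
  define J where "J = {d} * I"
  have tJ: "t_ideal R J" and JR: "J \<subseteq> R"
    using t_ideal_singleton_mult[OF I d(2)] d(3) by (auto simp: J_def set_times_def)
  obtain j where j: "j \<in> J" "j \<noteq> 0" using tJ by (rule t_ideal_nonzeroE)
  obtain g where g: "g \<in> J - {0}" and min: "\<And>h. (h, g) \<in> {(x, y). x \<in> carrier nonzero_monoid \<and>
      y \<in> carrier nonzero_monoid \<and> properfactor nonzero_monoid x y} \<Longrightarrow> h \<notin> J - {0}"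
    using wfE_min[OF division_wellfounded, of j "J - {0}"] j by auto
  have gR: "g \<in> R" "g \<noteq> 0" using g JR by auto
  have "b / g \<in> R" if b: "b \<in> J" "b \<noteq> 0" for b
  proof -
    have bR: "b \<in> R" using b JR by auto
    let ?h = "somegcd nonzero_monoid g b"
    have carr: "g \<in> carrier nonzero_monoid" "b \<in> carrier nonzero_monoid"
      using gR b bR by (simp_all only: nonzero_monoid_simps) auto
    have h: "?h \<in> carrier nonzero_monoid" by (rule gcd_closed[OF carr])
    have "?h \<in> t_hull {g, b}"
      by (rule gcd_in_t_hull[OF gcd_condition_monoid_axioms gR bR b(2)])
    then have "?h \<in> J" using t_hull_subset_t_ideal[OF tJ, of "{g, b}"] g b by auto
    moreover have "?h \<noteq> 0" using h by (simp only: nonzero_monoid_simps) auto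
    ultimately have "\<not> properfactor nonzero_monoid ?h g" using min h carr(1) by blast
    then have "g divides\<^bsub>nonzero_monoid\<^esub> ?h"
      using gcd_divides_l[OF carr] by (auto simp: properfactor_def)
    then have "g divides\<^bsub>nonzero_monoid\<^esub> b"
      using gcd_divides_r[OF carr] carr(1) by (rule divides_trans)
    then show ?thesis using divides_iff[OF gR b(2)] by simp
  qed
  then have "b \<in> {g} * R" if "b \<in> J" for b
    using that gR by (cases "b = 0") (auto simp: in_singleton_mult)
  moreover have "{g} * R \<subseteq> J" using t_ideal_scale_right[OF tJ] g by (auto simp: set_times_def)
  ultimately have "J = {g} * R" by blast
  then have "I = {inverse d * g} * R"
    using singleton_mult_cancel(1)[OF d(2), of I] by (simp add: J_def singleton_mult_singleton)
  then show ?thesis using d gR by (intro exI[of _ "inverse d * g"]) simp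
qed

text \<open>
  Conversely, a generator of the \<open>t\<close>-closure of \<open>{a, b}\<close> is a greatest common divisor, and an infinite
  chain of proper divisors is impossible because the union of the ideals it generates is a
  \<open>t\<close>-ideal, so principal.
\<close>

lemma principal_imp_ufd:
  assumes pr: "\<And>I. t_ideal R I \<Longrightarrow> \<exists>c. c \<noteq> 0 \<and> I = {c} * R"
  shows "ufd R"
proof -
  interpret comm_monoid_cancel nonzero_monoid by (rule comm_monoid_cancel_nonzero)
  have t_hull_principal: "t_hull ({f} * R) = {f} * R" if "f \<noteq> 0" for f
    using that by (simp add: t_hull_singleton_mult)
  have "gcd_condition_monoid nonzero_monoid"
  proof unfold_locales
    fix a b assume "a \<in> carrier nonzero_monoid" "b \<in> carrier nonzero_monoid"
    then have a: "a \<in> R" "a \<noteq> 0" and b: "b \<in> R" "b \<noteq> 0" by (auto simp only: nonzero_monoid_simps)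
    let ?I = "t_hull {a, b}"
    have IR: "?I \<subseteq> R" using a b by (intro t_hull_subset_R) auto
    have ab: "a \<in> ?I" "b \<in> ?I" using t_hull_superset[of "{a, b}"] by auto
    then have "t_ideal R ?I" using a IR by (intro t_ideal_subset_R_I[of ?I a]) auto
    then obtain c where c: "c \<noteq> 0" "?I = {c} * R" using pr by blast
    have "c \<in> ?I" using in_singleton_mult[OF c(1), of c] c by simp
    then have cR: "c \<in> R" using IR by blast
    have "c gcdof\<^bsub>nonzero_monoid\<^esub> a b"
      unfolding isgcd_def
    proof (intro conjI ballI impI)
      show "c divides\<^bsub>nonzero_monoid\<^esub> a" "c divides\<^bsub>nonzero_monoid\<^esub> b"
        using ab in_singleton_mult[OF c(1)] c(2) a b divides_iff[OF cR c(1)] by auto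
      fix y assume y: "y \<in> carrier nonzero_monoid"
        "y divides\<^bsub>nonzero_monoid\<^esub> a \<and> y divides\<^bsub>nonzero_monoid\<^esub> b"
      then have yR: "y \<in> R" "y \<noteq> 0" by (auto simp only: nonzero_monoid_simps)
      then have "{a, b} \<subseteq> {y} * R" using y(2) a b by (auto simp: in_singleton_mult divides_iff)
      then have "?I \<subseteq> {y} * R" using t_hull_mono[of "{a, b}" "{y} * R"] t_hull_principal yR by simp
      then show "y divides\<^bsub>nonzero_monoid\<^esub> c"
        using \<open>c \<in> ?I\<close> yR c(1) by (auto simp: in_singleton_mult divides_iff)
    qed
    then show "\<exists>c. c \<in> carrier nonzero_monoid \<and> c gcdof\<^bsub>nonzero_monoid\<^esub> a b"
      using cR c(1) by (intro exI[of _ c]) (simp only: nonzero_monoid_simps, simp)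
  qed
  moreover have "divisor_chain_condition_monoid nonzero_monoid"
  proof unfold_locales
    let ?r = "{(x, y). x \<in> carrier nonzero_monoid \<and> y \<in> carrier nonzero_monoid \<and>
      properfactor nonzero_monoid x y}"
    show "wf ?r"
      unfolding wf_iff_no_infinite_down_chain
    proof
      assume "\<exists>f. \<forall>i. (f (Suc i), f i) \<in> ?r"
      then obtain f where f: "\<And>i. (f (Suc i), f i) \<in> ?r" by blast
      have fR: "f i \<in> R" "f i \<noteq> 0" for i
        using f[of i] by (simp_all only: nonzero_monoid_simps) auto
      have step: "f i / f (Suc i) \<in> R" "f (Suc i) / f i \<notin> R" for i
        using f[of i] fR by (auto simp: properfactor_def divides_iff)
      define I where "I = (\<Union>i. {f i} * R)"
      have sub: "{f i} * R \<subseteq> {f (Suc i)} * R" for i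
      proof
        fix x assume "x \<in> {f i} * R"
        then have "(x / f i) * (f i / f (Suc i)) \<in> R"
          using step(1) fR by (intro mult_in) (auto simp: in_singleton_mult)
        then show "x \<in> {f (Suc i)} * R" using fR by (simp add: in_singleton_mult)
      qed
      have mono: "{f i} * R \<subseteq> {f j} * R" if "i \<le> j" for i j
        using lift_Suc_mono_le[of "\<lambda>i. {f i} * R", OF sub that] .
      have "t_hull I \<subseteq> I"
      proof
        fix x assume "x \<in> t_hull I"
        then obtain S where S: "finite S" "S \<subseteq> I" "x \<in> v_closure R S" by (rule t_hullE)
        have "\<exists>k. S \<subseteq> {f k} * R"
          using S(1,2)
        proof (induction S)
          case (insert s S)
          then obtain k l where "S \<subseteq> {f k} * R" "s \<in> {f l} * R" by (auto simp: I_def)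
          then have "insert s S \<subseteq> {f (max k l)} * R"
            using mono[of k "max k l"] mono[of l "max k l"] by auto
          then show ?case by blast
        qed simp
        then obtain k where "S \<subseteq> {f k} * R" by blast
        then have "x \<in> t_hull ({f k} * R)" using S by (auto simp: t_hull_def)
        then have "x \<in> {f k} * R" by (simp only: t_hull_principal[OF fR(2)])
        then show "x \<in> I" unfolding I_def by blast
      qed
      moreover have "I \<subseteq> R" using mult_in[OF fR(1)] by (auto simp: I_def set_times_def)
      moreover have in_I: "f i \<in> I" for i
      proof -
        have "f i \<in> {f i} * R" by (simp add: in_singleton_mult fR)
        then show ?thesis unfolding I_def by blast
      qed
      ultimately have "t_ideal R I"
        using t_hull_superset[of I] fR(2)[of 0] by (intro t_ideal_subset_R_I[of I "f 0"]) auto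
      then obtain c where c: "c \<noteq> 0" "I = {c} * R" using pr by blast
      then have "c \<in> I" using in_singleton_mult[OF c(1), of c] by simp
      then obtain k where "c \<in> {f k} * R" by (auto simp: I_def)
      then have "c / f k \<in> R" using in_singleton_mult fR by simp
      moreover have "f (Suc k) / c \<in> R" using in_I in_singleton_mult[OF c(1)] c(2) by simp
      ultimately have "(f (Suc k) / c) * (c / f k) \<in> R" by (intro mult_in)
      then show False using step(2)[of k] c(1) by simp
    qed
  qed
  ultimately show ?thesis
    unfolding ufd_iff_factorial factorial_condition_two[symmetric] by blast
qed

lemma principal_imp_t_invertible:
  assumes "c \<noteq> 0"
  shows "t_invertible ({c} * R)"
proof -
  have "c * inverse c \<in> ({c} * R) * inverse_ideal R ({c} * R)"
  proof (rule set_times_intro)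
    show "c \<in> {c} * R" by (auto simp: set_times_def intro: bexI[of _ 1])
    show "inverse c \<in> inverse_ideal R ({c} * R)"
      using assms by (auto simp: in_inverse_ideal in_singleton_mult divide_inverse_commute)
  qed
  then show ?thesis using assms t_hull_superset unfolding t_invertible_def by auto
qed

lemma principal_imp_boole:
  assumes pr: "\<And>I. t_ideal R I \<Longrightarrow> \<exists>c. c \<noteq> 0 \<and> I = {c} * R"
  shows "boole_t_regular R"
  unfolding boole_t_regular_iff
proof (intro allI impI)
  fix I assume I: "t_ideal R I"
  then obtain c where c: "c \<noteq> 0" "I = {c} * R" using pr by blast
  have "I * I = {c} * (R * I)" using c(2) by (simp only: mult.assoc)
  then have "t_hull (I * I) = {c} * I"
    using c(1) I by (simp add: R_mult_t_ideal t_hull_singleton_mult t_ideal_t_hull)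
  then show "\<exists>c. c \<noteq> 0 \<and> t_hull (I * I) = {c} * I" using c(1) by blast
qed

text \<open>Multiply \<open>(I I)\<^sub>t = c I\<close> by \<open>I\<inverse>\<close>.\<close>

lemma boole_t_invertible_imp_principal:
  assumes "boole_t_regular R" and I: "t_ideal R I" and inv: "t_invertible I"
  shows "\<exists>c. c \<noteq> 0 \<and> I = {c} * R"
proof -
  let ?J = "inverse_ideal R I"
  obtain c where c: "c \<noteq> 0" "t_hull (I * I) = {c} * I"
    using assms(1) I by (auto simp: boole_t_regular_iff)
  have "I = t_hull (t_hull (I * ?J) * I)"
    using I by (simp only: t_hull_mult_inverse_ideal[OF inv] R_mult_t_ideal t_ideal_t_hull)
  also have "\<dots> = t_hull (t_hull (I * I) * ?J)"
    unfolding t_hull_mult_left by (simp only: ac_simps)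
  also have "\<dots> = t_hull ({c} * (I * ?J))" by (simp only: c(2) mult.assoc)
  also have "\<dots> = {c} * R"
    by (simp only: t_hull_singleton_mult[OF c(1)] t_hull_mult_inverse_ideal[OF inv])
  finally show ?thesis using c(1) by blast
qed

section \<open>The two equivalences\<close>

lemma krull_iff: "krull_domain R \<longleftrightarrow> (\<forall>I. t_ideal R I \<longrightarrow> t_invertible I)"
  using krull_imp_t_invertible t_invertible_imp_krull by blast

lemma clifford_imp_iff_krull:
  assumes "clifford_t_regular R"
  shows "t_almost_dedekind R \<longleftrightarrow> krull_domain R"
    and "strongly_t_discrete R \<and> completely_integrally_closed R \<longleftrightarrow> krull_domain R"
  using assms clifford_imp_t_invertible t_invertible_imp_t_almost_dedekind krull_iff
    t_almost_dedekind_imp_completely_integrally_closed t_almost_dedekind_imp_strongly_t_discrete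
  by blast+

lemma ufd_iff: "ufd R \<longleftrightarrow> krull_domain R \<and> boole_t_regular R"
proof
  assume "ufd R"
  then have pr: "\<exists>c. c \<noteq> 0 \<and> I = {c} * R" if "t_ideal R I" for I using that ufd_imp_principal by blast
  then have "t_invertible I" if "t_ideal R I" for I
    using principal_imp_t_invertible that by metis
  then show "krull_domain R \<and> boole_t_regular R" using principal_imp_boole[OF pr] krull_iff by blast
next
  assume "krull_domain R \<and> boole_t_regular R"
  then have "\<exists>c. c \<noteq> 0 \<and> I = {c} * R" if "t_ideal R I" for I
    using that boole_t_invertible_imp_principal krull_iff by blast
  then show "ufd R" by (rule principal_imp_ufd)
qed

end

theorem proposition2p3:
  fixes R :: "'k::field set"
  assumes "domain_with_quotient_field R"
  shows "((krull_domain R \<longleftrightarrow> t_almost_dedekind R \<and> clifford_t_regular R) \<and>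
          (t_almost_dedekind R \<and> clifford_t_regular R \<longleftrightarrow>
            strongly_t_discrete R \<and> completely_integrally_closed R \<and> clifford_t_regular R)) \<and>
         ((ufd R \<longleftrightarrow> t_almost_dedekind R \<and> boole_t_regular R) \<and>
          (t_almost_dedekind R \<and> boole_t_regular R \<longleftrightarrow>
            strongly_t_discrete R \<and> completely_integrally_closed R \<and> boole_t_regular R))"
proof -
  interpret domain_in_field R by unfold_locales (rule assms)
  have "krull_domain R \<Longrightarrow> clifford_t_regular R"
    using krull_iff t_invertible_imp_clifford by blast
  then show ?thesis
    using clifford_imp_iff_krull boole_imp_clifford ufd_iff by blast
qed

end
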